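(* Let $Y'(\tilde z)=A(z)Y(\tilde z)$ be an $n\times n$ system of standard form with $m$ singularities $a_1,\dots,a_m\in\mathbb C$. If the monodromy of this system is irreducible, then the indices $\varkappa_1,\dots,\varkappa_n\in\mathbb Z$ satisfy, for each $k=1,\dots,n-1$, the condition $$\varkappa_k-\varkappa_{k+1}\le m-2.$$
   Context: $\dot{\mathbb C}=\mathbb C\cup\{\infty\}$; $G\mathbb C^{n\times n}$ is the group of invertible complex $n\times n$ matrices; for single matrices $M\sim M'$ means similarity. The distinct points $a_1,\dots,a_m\in\mathbb C$ lie in this order on a fixed smooth (simple) closed positively oriented curve $\Gamma\subset\mathbb C$ (indices cyclic). Let $S=\dot{\mathbb C}\setminus\{a_1,\dots,a_m\}$, $\rho:\tilde S\to S$ its universal covering, write $z=\rho(\tilde z)$ for $\tilde z\in\tilde S$, and $\tilde S^*=\tilde S\setminus\rho^{-1}(\infty)$. For small $\delta>0$, $D_a=\{0<|z-a|<\delta\}$ ($a\in\mathbb C$), $D_\infty=\{|z|>1/\delta\}$, $\tilde D_a$ is the universal covering of $D_a$, and $(\tilde z-a)^E=\exp(E\ln(\tilde z-a))$ on $\tilde D_a$. Fix $\tilde z_0\in\tilde S$ with $\rho(\tilde z_0)$ inside $\Gamma$; for each $k$ let $\tilde z_k$ be the endpoint of a simple path in $\tilde S$ starting at $\tilde z_0$ whose projection is a closed curve based at $\rho(\tilde z_0)$ meeting $\Gamma$ exactly twice, first on the subarc joining $a_{k-1}$ and $a_k$, then on the subarc joining $a_k$ and $a_{k+1}$ (so it goes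 once around $a_k$ in the positive direction), and let $\sigma_k$ be the deck transformation of $\tilde S$ with $\sigma_k(\tilde z_0)=\tilde z_k$. For a solution $Y:\tilde S^*\to G\mathbb C^{n\times n}$ of a linear system $Y'(\tilde z)=A(z)Y(\tilde z)$, the matrices $\chi(\sigma)$ are defined by $Y(\tilde z)=Y(\sigma(\tilde z))\chi(\sigma)$. Two $m$-tuples of matrices are equivalent if they are simultaneously similar; $[\cdot]_\sim$ is the equivalence class. The monodromy of the system is $[\chi(\sigma_1),\dots,\chi(\sigma_m)]_\sim$; it is irreducible if $\chi(\sigma_1),\dots,\chi(\sigma_m)$ have no common invariant subspace $X\subseteq\mathbb C^n$ other than $\{0\}$ and $\mathbb C^n$. A matrix is non-resonant if no two of its eigenvalues differ by a nonzero integer. Tuples $[M_1,\dots,M_m]$, $[E_1,\dots,E_m]$ of $n\times n$ matrices are admissible data if $M_1\cdots M_m=I$, $M_k\sim\exp(-2\pi iE_k)$ for each $k$, and all $E_k$ are non-resonant. The system $Y'(\tilde z)=A(z)Y(\tilde z)$ is of standard form (with respect to some such admissible data), with singularities $a_1,\dots,a_m$ and indices $\varkappa_1\ge\dots\ge\varkappa_n$ (integers) if: (i) it has singularities only at $a_1,\dots,a_m$ and at infinity (i.e. $A$ is analytic on $\mathbb C\setminus\{a_1,\dots,a_m\}$), the singularity at infinity being apparent (solutions have no branching there); (ii) its monodromy is $[M_1,\dots,M_m]_\sim$; (iii) for each $k$ the solutions on $\tilde D_{a_k}$ can be written $Y(\tilde z)=Z_k(z)(\tilde z-a_k)^{E_k}C$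 with $Z_k:D_{a_k}\cup\{a_k\}\to G\mathbb C^{n\times n}$ analytic and $C\in G\mathbb C^{n\times n}$; (iv) the solutions on $D_\infty$ can be written $Y(z)=\mathrm{diag}(z^{\varkappa_1},\dots,z^{\varkappa_n})Z_\infty(z)C$ with $Z_\infty:D_\infty\cup\{\infty\}\to G\mathbb C^{n\times n}$ analytic and $C\in G\mathbb C^{n\times n}$. *)

theory Defs
  imports "HOL-Complex_Analysis.Complex_Analysis" "Jordan_Normal_Form.Char_Poly"
    "Jordan_Normal_Form.VS_Connect"
begin

text \<open>The sphere is the one-point compactification of the complex plane. It is a type of its own
  so that the library notions \<^const>\<open>covering_space\<close> and \<^const>\<open>simply_connected\<close> apply to it.\<close>

datatype sphere_pt = Fin_pt (coord: complex) | Inf_pt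

instantiation sphere_pt :: topological_space
begin

definition open_sphere_pt :: "sphere_pt set \<Rightarrow> bool" where
  "open_sphere_pt U \<longleftrightarrow>
     open (Fin_pt -` U) \<and> (Inf_pt \<in> U \<longrightarrow> compact (- (Fin_pt -` U)))"

instance
proof
  show "open (UNIV :: sphere_pt set)"
    by (simp add: open_sphere_pt_def)
next
  fix U V :: "sphere_pt set"
  assume "open U" "open V"
  then show "open (U \<inter> V)"
    by (auto simp: open_sphere_pt_def vimage_Int Compl_Int intro!: open_Int compact_Un)
next
  fix K :: "sphere_pt set set"
  assume K: "\<forall>U\<in>K. open U"
  have op: "open (Fin_pt -` \<Union>K)"
    using K by (auto simp: open_sphere_pt_def vimage_Union)
  moreover have "compact (- (Fin_pt -` \<Union>K))" if inf: "Inf_pt \<in> \<Union>K"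
  proof -
    from inf obtain U where U: "U \<in> K" "Inf_pt \<in> U" by blast
    then have "compact (- (Fin_pt -` U))"
      using K by (auto simp: open_sphere_pt_def)
    moreover have "closed (- (Fin_pt -` \<Union>K))"
      using op by (simp add: closed_Compl)
    ultimately have "compact (- (Fin_pt -` U) \<inter> - (Fin_pt -` \<Union>K))"
      by (rule compact_Int_closed)
    moreover have "- (Fin_pt -` U) \<inter> - (Fin_pt -` \<Union>K) = - (Fin_pt -` \<Union>K)"
      using U by auto
    ultimately show ?thesis by simp
  qed
  ultimately show "open (\<Union>K)"
    by (simp add: open_sphere_pt_def)
qed

end

definition punctured_sphere :: "(nat \<Rightarrow> complex) \<Rightarrow> nat \<Rightarrow> sphere_pt set" where
  "punctured_sphere a m = UNIV - Fin_pt ` a ` {1..m}"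

definition universal_covering ::
  "'t::topological_space set \<Rightarrow> ('t \<Rightarrow> sphere_pt) \<Rightarrow> sphere_pt set \<Rightarrow> bool" where
  "universal_covering St \<rho> S \<longleftrightarrow> covering_space St \<rho> S \<and> simply_connected St"

definition deck_transformation ::
  "'t::topological_space set \<Rightarrow> ('t \<Rightarrow> sphere_pt) \<Rightarrow> ('t \<Rightarrow> 't) \<Rightarrow> bool" where
  "deck_transformation St \<rho> \<sigma> \<longleftrightarrow>
     (\<exists>\<tau>. homeomorphism St St \<sigma> \<tau>) \<and> (\<forall>w\<in>St. \<rho> (\<sigma> w) = \<rho> w)"

definition finite_part :: "'t set \<Rightarrow> ('t \<Rightarrow> sphere_pt) \<Rightarrow> 't set" where
  "finite_part St \<rho> = St - \<rho> -` {Inf_pt}"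

text \<open>A closed curve is given by a parametrization of period 1 on the whole real line; its
  restriction to the unit interval is the closed path in the sense of the library.\<close>

definition smooth_closed_curve :: "(real \<Rightarrow> complex) \<Rightarrow> bool" where
  "smooth_closed_curve \<gamma> \<longleftrightarrow>
     (\<forall>s. \<gamma> (s + 1) = \<gamma> s) \<and> simple_path \<gamma> \<and>
     (\<exists>\<gamma>'. continuous_on UNIV \<gamma>' \<and>
        (\<forall>s. (\<gamma> has_vector_derivative \<gamma>' s) (at s) \<and> \<gamma>' s \<noteq> 0))"

definition positively_oriented :: "(real \<Rightarrow> complex) \<Rightarrow> bool" where
  "positively_oriented \<gamma> \<longleftrightarrow> (\<forall>z\<in>inside (path_image \<gamma>). winding_number \<gamma> z = 1)"

text \<open>The points \<open>a 1, \<dots>, a m\<close> lie in this order on the curve, \<open>t k\<close> being the parameter of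
  \<open>a k\<close>. The additional parameters \<open>t 0\<close> and \<open>t (m + 1)\<close> are those of \<open>a m\<close> one period earlier and
  of \<open>a 1\<close> one period later, so that \<open>\<gamma> ` {t k<..<t (k + 1)}\<close> is, for \<open>k = 0, \<dots>, m\<close>,
  the open subarc from \<open>a k\<close> to \<open>a (k + 1)\<close> with cyclic indices.\<close>

definition in_order_on_curve ::
  "(real \<Rightarrow> complex) \<Rightarrow> (nat \<Rightarrow> real) \<Rightarrow> (nat \<Rightarrow> complex) \<Rightarrow> nat \<Rightarrow> bool" where
  "in_order_on_curve \<gamma> t a m \<longleftrightarrow>
     1 \<le> m \<and> t 0 = t m - 1 \<and> t (m + 1) = t 1 + 1 \<and> (\<forall>k\<le>m. t k < t (k + 1)) \<and>
     (\<forall>k\<in>{1..m}. a k = \<gamma> (t k))"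

text \<open>The lifted path \<open>p\<close> leaves the inside of the curve through the subarc ending in \<open>a k\<close>, stays
  outside (possibly passing through infinity) and returns through the subarc starting in \<open>a k\<close>.
  The condition on the open interval \<open>{s1<..<s2}\<close> excludes paths that only touch the curve from
  the inside and therefore do not go around \<open>a k\<close>.\<close>

definition generating_path ::
  "'t::topological_space set \<Rightarrow> ('t \<Rightarrow> sphere_pt) \<Rightarrow> (real \<Rightarrow> complex) \<Rightarrow> (nat \<Rightarrow> real) \<Rightarrow>
     't \<Rightarrow> nat \<Rightarrow> (real \<Rightarrow> 't) \<Rightarrow> bool" where
  "generating_path St \<rho> \<gamma> t z0 k p \<longleftrightarrow>
     simple_path p \<and> path_image p \<subseteq> St \<and> pathstart p = z0 \<and> \<rho> (pathfinish p) = \<rho> z0 \<and>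
     (\<exists>s1 s2. s1 < s2 \<and>
        {s \<in> {0..1}. \<rho> (p s) \<in> Fin_pt ` path_image \<gamma>} = {s1, s2} \<and>
        \<rho> (p s1) \<in> Fin_pt ` \<gamma> ` {t (k - 1)<..<t k} \<and>
        \<rho> (p s2) \<in> Fin_pt ` \<gamma> ` {t k<..<t (k + 1)} \<and>
        (\<forall>s\<in>{s1<..<s2}. \<rho> (p s) \<notin> Fin_pt ` inside (path_image \<gamma>)))"

definition generating_deck_transformation ::
  "'t::topological_space set \<Rightarrow> ('t \<Rightarrow> sphere_pt) \<Rightarrow> (real \<Rightarrow> complex) \<Rightarrow> (nat \<Rightarrow> real) \<Rightarrow>
     't \<Rightarrow> nat \<Rightarrow> ('t \<Rightarrow> 't) \<Rightarrow> bool" where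
  "generating_deck_transformation St \<rho> \<gamma> t z0 k \<sigma> \<longleftrightarrow>
     deck_transformation St \<rho> \<sigma> \<and>
     (\<exists>p. generating_path St \<rho> \<gamma> t z0 k p \<and> \<sigma> z0 = pathfinish p)"

definition GL :: "nat \<Rightarrow> complex mat set" where
  "GL n = {P \<in> carrier_mat n n. invertible_mat P}"

definition mat_exp :: "complex mat \<Rightarrow> complex mat" where
  "mat_exp B = mat (dim_row B) (dim_col B) (\<lambda>ij. \<Sum>l. (B ^\<^sub>m l) $$ ij / fact l)"

definition non_resonant :: "complex mat \<Rightarrow> bool" where
  "non_resonant B \<longleftrightarrow>
     \<not> (\<exists>x y. eigenvalue B x \<and> eigenvalue B y \<and> x \<noteq> y \<and> x - y \<in> \<int>)"

text \<open>An \<open>m\<close>-tuple of matrices is a function on \<open>{1..m}\<close>; its values elsewhere are irrelevant.\<close>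

definition simultaneously_similar ::
  "nat \<Rightarrow> (nat \<Rightarrow> complex mat) \<Rightarrow> (nat \<Rightarrow> complex mat) \<Rightarrow> bool" where
  "simultaneously_similar m M N \<longleftrightarrow>
     (\<exists>P Q. \<forall>k\<in>{1..m}. similar_mat_wit (M k) (N k) P Q)"

definition similarity_class ::
  "nat \<Rightarrow> (nat \<Rightarrow> complex mat) \<Rightarrow> (nat \<Rightarrow> complex mat) set" where
  "similarity_class m M = {N. simultaneously_similar m N M}"

definition irreducible_tuple :: "nat \<Rightarrow> nat \<Rightarrow> (nat \<Rightarrow> complex mat) \<Rightarrow> bool" where
  "irreducible_tuple n m M \<longleftrightarrow>
     (\<forall>X. VectorSpace.subspace class_ring X (module_vec TYPE(complex) n) \<and>
          (\<forall>k\<in>{1..m}. \<forall>v\<in>X. M k *\<^sub>v v \<in> X) \<longrightarrow>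
          X = {0\<^sub>v n} \<or> X = carrier_vec n)"

definition admissible_data ::
  "nat \<Rightarrow> nat \<Rightarrow> (nat \<Rightarrow> complex mat) \<Rightarrow> (nat \<Rightarrow> complex mat) \<Rightarrow> bool" where
  "admissible_data n m M E \<longleftrightarrow>
     (\<forall>k\<in>{1..m}. M k \<in> carrier_mat n n \<and> E k \<in> carrier_mat n n) \<and>
     foldr (*) (map M [1..<m + 1]) (1\<^sub>m n) = 1\<^sub>m n \<and>
     (\<forall>k\<in>{1..m}. similar_mat (M k) (mat_exp ((- 2 * of_real pi * \<i>) \<cdot>\<^sub>m E k))) \<and>
     (\<forall>k\<in>{1..m}. non_resonant (E k))"

definition analytic_GL :: "nat \<Rightarrow> (complex \<Rightarrow> complex mat) \<Rightarrow> complex set \<Rightarrow> bool" where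
  "analytic_GL n Z D \<longleftrightarrow>
     (\<forall>z\<in>D. Z z \<in> GL n) \<and> (\<forall>i<n. \<forall>j<n. (\<lambda>z. Z z $$ (i, j)) analytic_on D)"

text \<open>\<open>D\<close> is a space spread over the plane with projection \<open>\<pi>\<close>, which is a local coordinate near every
  point of \<open>D\<close>. The derivative of \<open>Y\<close> is taken with respect to this coordinate.\<close>

definition gl_solution ::
  "nat \<Rightarrow> (complex \<Rightarrow> complex mat) \<Rightarrow> 't::topological_space set \<Rightarrow> ('t \<Rightarrow> complex) \<Rightarrow>
     ('t \<Rightarrow> complex mat) \<Rightarrow> bool" where
  "gl_solution n A D \<pi> Y \<longleftrightarrow>
     (\<forall>w\<in>D. Y w \<in> GL n \<and>
        (\<forall>i<n. \<forall>j<n.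
           ((\<lambda>v. (Y v $$ (i, j) - Y w $$ (i, j)) / (\<pi> v - \<pi> w))
              \<longlongrightarrow> (A (\<pi> w) * Y w) $$ (i, j)) (at w within D)))"

definition global_solution ::
  "'t::topological_space set \<Rightarrow> ('t \<Rightarrow> sphere_pt) \<Rightarrow> nat \<Rightarrow> (complex \<Rightarrow> complex mat) \<Rightarrow>
     ('t \<Rightarrow> complex mat) \<Rightarrow> bool" where
  "global_solution St \<rho> n A Y \<longleftrightarrow> gl_solution n A (finite_part St \<rho>) (\<lambda>w. coord (\<rho> w)) Y"

definition is_chi ::
  "'t set \<Rightarrow> ('t \<Rightarrow> sphere_pt) \<Rightarrow> nat \<Rightarrow> ('t \<Rightarrow> complex mat) \<Rightarrow> ('t \<Rightarrow> 't) \<Rightarrow> complex mat \<Rightarrow> bool"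
  where
  "is_chi St \<rho> n Y \<sigma> X \<longleftrightarrow>
     X \<in> carrier_mat n n \<and> (\<forall>w\<in>finite_part St \<rho>. Y w = Y (\<sigma> w) * X)"

definition monodromy_tuple ::
  "'t::topological_space set \<Rightarrow> ('t \<Rightarrow> sphere_pt) \<Rightarrow> nat \<Rightarrow> nat \<Rightarrow> (nat \<Rightarrow> 't \<Rightarrow> 't) \<Rightarrow>
     (complex \<Rightarrow> complex mat) \<Rightarrow> (nat \<Rightarrow> complex mat) \<Rightarrow> bool" where
  "monodromy_tuple St \<rho> n m \<sigma> A X \<longleftrightarrow>
     (\<exists>Y. global_solution St \<rho> n A Y \<and> (\<forall>k\<in>{1..m}. is_chi St \<rho> n Y (\<sigma> k) (X k)))"

definition has_monodromy ::
  "'t::topological_space set \<Rightarrow> ('t \<Rightarrow> sphere_pt) \<Rightarrow> nat \<Rightarrow> nat \<Rightarrow> (nat \<Rightarrow> 't \<Rightarrow> 't) \<Rightarrow>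
     (complex \<Rightarrow> complex mat) \<Rightarrow> (nat \<Rightarrow> complex mat) set \<Rightarrow> bool" where
  "has_monodromy St \<rho> n m \<sigma> A C \<longleftrightarrow>
     (\<exists>X. monodromy_tuple St \<rho> n m \<sigma> A X \<and> C = similarity_class m X)"

text \<open>The tuples belonging to different solutions are simultaneously similar, so it does not matter
  for which solution irreducibility is required.\<close>

definition irreducible_monodromy ::
  "'t::topological_space set \<Rightarrow> ('t \<Rightarrow> sphere_pt) \<Rightarrow> nat \<Rightarrow> nat \<Rightarrow> (nat \<Rightarrow> 't \<Rightarrow> 't) \<Rightarrow>
     (complex \<Rightarrow> complex mat) \<Rightarrow> bool" where
  "irreducible_monodromy St \<rho> n m \<sigma> A \<longleftrightarrow>
     (\<exists>X. monodromy_tuple St \<rho> n m \<sigma> A X \<and> irreducible_tuple n m X)"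

text \<open>The universal covering of the punctured disc of radius \<open>\<delta>\<close> around \<open>c\<close> is the half plane
  \<open>{\<zeta>. Re \<zeta> < ln \<delta>}\<close> with projection \<open>\<zeta> \<mapsto> c + exp \<zeta>\<close>. In this model the logarithm of
  \<open>z - c\<close> is the coordinate \<open>\<zeta>\<close> itself, so that the power with exponent \<open>E\<close>
  is \<open>mat_exp (\<zeta> \<cdot>\<^sub>m E)\<close>. The equivalence says that the solutions are precisely the functions
  of the given form.\<close>

definition standard_at_finite ::
  "nat \<Rightarrow> (complex \<Rightarrow> complex mat) \<Rightarrow> real \<Rightarrow> complex \<Rightarrow> complex mat \<Rightarrow> bool" where
  "standard_at_finite n A \<delta> c E \<longleftrightarrow>
     (\<exists>Z. analytic_GL n Z (ball c \<delta>) \<and>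
        (\<forall>Y. gl_solution n A {\<zeta>. Re \<zeta> < ln \<delta>} (\<lambda>\<zeta>. c + exp \<zeta>) Y \<longleftrightarrow>
           (\<exists>C\<in>GL n. \<forall>\<zeta>. Re \<zeta> < ln \<delta> \<longrightarrow>
              Y \<zeta> = Z (c + exp \<zeta>) * mat_exp (\<zeta> \<cdot>\<^sub>m E) * C)))"

text \<open>The factor that is analytic near infinity, including infinity itself, is written as
  \<open>H (1 / z)\<close> with \<open>H\<close> analytic on the disc of radius \<open>\<delta>\<close> around 0.
  Matrix indices start at 0, those of \<open>\<kappa>\<close> at 1.\<close>

definition standard_at_infinity ::
  "nat \<Rightarrow> (complex \<Rightarrow> complex mat) \<Rightarrow> real \<Rightarrow> (nat \<Rightarrow> int) \<Rightarrow> bool" where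
  "standard_at_infinity n A \<delta> \<kappa> \<longleftrightarrow>
     (\<exists>H. analytic_GL n H (ball 0 \<delta>) \<and>
        (\<forall>Y. gl_solution n A {z. cmod z > 1 / \<delta>} (\<lambda>z. z) Y \<longleftrightarrow>
           (\<exists>C\<in>GL n. \<forall>z. cmod z > 1 / \<delta> \<longrightarrow>
              Y z = mat_diag n (\<lambda>i. z powi \<kappa> (i + 1)) * H (1 / z) * C)))"

text \<open>The singularity at infinity is apparent: the punctured sphere contains infinity, so a loop
  around infinity lifts to a closed loop in its universal covering, and \<^const>\<open>has_monodromy\<close>
  requires a solution that is single-valued on the covering space without the points over infinity.
  The single-valued solutions of \<^const>\<open>standard_at_infinity\<close> express the same.\<close>

definition standard_form ::
  "'t::topological_space set \<Rightarrow> ('t \<Rightarrow> sphere_pt) \<Rightarrow> nat \<Rightarrow> nat \<Rightarrow> (nat \<Rightarrow> 't \<Rightarrow> 't) \<Rightarrow>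
     (nat \<Rightarrow> complex) \<Rightarrow> (complex \<Rightarrow> complex mat) \<Rightarrow> (nat \<Rightarrow> int) \<Rightarrow> bool" where
  "standard_form St \<rho> n m \<sigma> a A \<kappa> \<longleftrightarrow>
     (\<forall>k\<in>{1..<n}. \<kappa> (k + 1) \<le> \<kappa> k) \<and>
     (\<forall>z\<in>- a ` {1..m}. A z \<in> carrier_mat n n) \<and>
     (\<forall>i<n. \<forall>j<n. (\<lambda>z. A z $$ (i, j)) analytic_on - a ` {1..m}) \<and>
     (\<exists>M E. admissible_data n m M E \<and>
        has_monodromy St \<rho> n m \<sigma> A (similarity_class m M) \<and>
        (\<exists>\<delta>>0. (\<forall>k\<in>{1..m}. ball (a k) \<delta> \<inter> a ` {1..m} = {a k} \<and> cmod (a k) \<le> 1 / \<delta>) \<and>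
           (\<forall>k\<in>{1..m}. standard_at_finite n A \<delta> (a k) (E k)) \<and>
           standard_at_infinity n A \<delta> \<kappa>))"

end

theory Submission
  imports Defs
begin

unbundle no vec_syntax

text \<open>The coefficient matrix \<open>A\<close> has at most simple poles at the points \<open>a\<^sub>l\<close>, and the form of the
  solutions at infinity gives \<open>A\<^sub>i\<^sub>j = O(z\<^bsup>\<kappa>\<^sub>i - \<kappa>\<^sub>j - 2\<^esup>)\<close> for \<open>i \<noteq> j\<close>. If some gap
  \<open>\<kappa>\<^sub>k - \<kappa>\<^sub>k\<^sub>+\<^sub>1\<close> were at least \<open>m - 1\<close>, then for \<open>j \<le> k < i\<close> the product of \<open>A\<^sub>i\<^sub>j\<close> with
  all \<open>z - a\<^sub>l\<close> would be an entire function vanishing at infinity, so \<open>A\<^sub>i\<^sub>j = 0\<close>. Hence the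
  vector solutions whose components beyond the \<open>k\<close>-th vanish at one point keep this property
  on all of the covering space. They form a \<open>k\<close>-dimensional space invariant under the monodromy.\<close>

section \<open>Limits of matrices and the matrix exponential\<close>

lemma index_mult_mat_sum:
  assumes "P \<in> carrier_mat n r" "Q \<in> carrier_mat r s" "i < n" "j < s"
  shows "(P * Q) $$ (i, j) = (\<Sum>l<r. P $$ (i, l) * Q $$ (l, j))"
  using assms by (simp add: scalar_prod_def atLeast0LessThan)

lemma tendsto_det:
  fixes L :: "'a::real_normed_field mat"
  assumes "\<And>i j. i < n \<Longrightarrow> j < n \<Longrightarrow> ((\<lambda>x. P x $$ (i, j)) \<longlongrightarrow> L $$ (i, j)) F"
    and "\<forall>\<^sub>F x in F. P x \<in> carrier_mat n n" and "L \<in> carrier_mat n n"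
  shows "((\<lambda>x. det (P x)) \<longlongrightarrow> det L) F"
proof (rule Lim_transform_eventually)
  show "((\<lambda>x. \<Sum>p | p permutes {0..<n}. signof p * (\<Prod>i = 0..<n. P x $$ (i, p i))) \<longlongrightarrow> det L) F"
    unfolding det_def'[OF assms(3)]
    by (intro tendsto_intros assms(1)) (auto simp: permutes_in_image dest: permutes_nat_less)
  show "\<forall>\<^sub>F x in F. (\<Sum>p | p permutes {0..<n}. signof p * (\<Prod>i = 0..<n. P x $$ (i, p i)))
      = det (P x)"
    using assms(2) by eventually_elim (simp add: det_def')
qed

text \<open>Each entry is a cofactor, that is, a signed determinant of a minor, so
  \<open>tendsto_det\<close> applies in size \<open>n - 1\<close>.\<close>

lemma tendsto_adj_mat:
  fixes L :: "'a::real_normed_field mat"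
  assumes "\<And>i j. i < n \<Longrightarrow> j < n \<Longrightarrow> ((\<lambda>x. P x $$ (i, j)) \<longlongrightarrow> L $$ (i, j)) F"
    and "\<forall>\<^sub>F x in F. P x \<in> carrier_mat n n" and "L \<in> carrier_mat n n"
    and "i < n" "j < n"
  shows "((\<lambda>x. adj_mat (P x) $$ (i, j)) \<longlongrightarrow> adj_mat L $$ (i, j)) F"
proof (rule Lim_transform_eventually)
  have entry: "adj_mat Q $$ (i, j) = (- 1) ^ (j + i) * det (mat_delete Q j i)"
    if "Q \<in> carrier_mat n n" for Q :: "'a mat"
    using that assms(4,5) by (auto simp: adj_mat_def cofactor_def)
  have del: "mat_delete Q j i \<in> carrier_mat (n - 1) (n - 1)"
    if "Q \<in> carrier_mat n n" for Q :: "'a mat"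
    using that by (rule mat_delete_carrier)
  show "((\<lambda>x. (- 1) ^ (j + i) * det (mat_delete (P x) j i)) \<longlongrightarrow> adj_mat L $$ (i, j)) F"
    unfolding entry[OF assms(3)]
  proof (intro tendsto_intros tendsto_det[where n = "n - 1"])
    show "\<forall>\<^sub>F x in F. mat_delete (P x) j i \<in> carrier_mat (n - 1) (n - 1)"
      using assms(2) by eventually_elim (rule del)
    show "mat_delete L j i \<in> carrier_mat (n - 1) (n - 1)"
      by (rule del[OF assms(3)])
    fix r s assume rs: "r < n - 1" "s < n - 1"
    \<comment> \<open>Deleting row \<open>j\<close> and column \<open>i\<close> moves the later
      indices down by one; \<open>r'\<close> and \<open>s'\<close> recover the original
      positions.\<close>
    define r' s' where "r' = (if r < j then r else Suc r)" and "s' = (if s < i then s else Suc s)"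
    have entry': "mat_delete Q j i $$ (r, s) = Q $$ (r', s')" if "Q \<in> carrier_mat n n" for Q :: "'a mat"
      using that rs by (auto simp: mat_delete_def r'_def s'_def)
    have "r' < n" "s' < n"
      using rs by (auto simp: r'_def s'_def)
    show "((\<lambda>x. mat_delete (P x) j i $$ (r, s)) \<longlongrightarrow> mat_delete L j i $$ (r, s)) F"
      unfolding entry'[OF assms(3)]
    proof (rule Lim_transform_eventually[OF assms(1)[OF \<open>r' < n\<close> \<open>s' < n\<close>]])
      show "\<forall>\<^sub>F x in F. P x $$ (r', s') = mat_delete (P x) j i $$ (r, s)"
        using assms(2) by eventually_elim (rule entry'[symmetric])
    qed
  qed
  show "\<forall>\<^sub>F x in F. (- 1) ^ (j + i) * det (mat_delete (P x) j i) = adj_mat (P x) $$ (i, j)"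
    using assms(2) by eventually_elim (rule entry[symmetric])
qed

text \<open>Cramer's rule: \<open>G x\<close> is \<open>K x * adj_mat (P x)\<close> divided by
  \<open>det (P x)\<close>, and this denominator has a nonzero limit. In the applications
  \<open>G\<close> is a rescaled coefficient matrix and \<open>P\<close> the analytic invertible
  factor of a solution, so that the growth of the coefficients is read off from that factor.\<close>

lemma left_factor_convergent:
  fixes L :: "'a::real_normed_field mat" and K0 :: "nat \<Rightarrow> nat \<Rightarrow> 'a"
  assumes P: "\<And>i j. i < n \<Longrightarrow> j < n \<Longrightarrow> ((\<lambda>x. P x $$ (i, j)) \<longlongrightarrow> L $$ (i, j)) F"
    and K: "\<And>i j. i < n \<Longrightarrow> j < n \<Longrightarrow> ((\<lambda>x. K x $$ (i, j)) \<longlongrightarrow> K0 i j) F"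
    and ev: "\<forall>\<^sub>F x in F. P x \<in> carrier_mat n n \<and> G x \<in> carrier_mat n n \<and> G x * P x = K x"
    and L: "L \<in> carrier_mat n n" "det L \<noteq> 0" and ij: "i < n" "j < n"
  shows "\<exists>l. ((\<lambda>x. G x $$ (i, j)) \<longlongrightarrow> l) F"
proof
  have evP: "\<forall>\<^sub>F x in F. P x \<in> carrier_mat n n"
    using ev by eventually_elim simp
  have detP: "((\<lambda>x. det (P x)) \<longlongrightarrow> det L) F"
    by (rule tendsto_det[OF P evP L(1)])
  show "((\<lambda>x. G x $$ (i, j)) \<longlongrightarrow> (\<Sum>l<n. K0 i l * adj_mat L $$ (l, j)) / det L) F"
  proof (rule Lim_transform_eventually)
    show "((\<lambda>x. (\<Sum>l<n. K x $$ (i, l) * adj_mat (P x) $$ (l, j)) / det (P x)) \<longlongrightarrow>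
        (\<Sum>l<n. K0 i l * adj_mat L $$ (l, j)) / det L) F"
      by (intro tendsto_intros detP L(2) K ij tendsto_adj_mat[OF P evP L(1)]) auto
    have "\<forall>\<^sub>F x in F. det (P x) \<noteq> 0"
      by (rule tendsto_imp_eventually_ne[OF detP L(2)])
    then show "\<forall>\<^sub>F x in F.
        (\<Sum>l<n. K x $$ (i, l) * adj_mat (P x) $$ (l, j)) / det (P x) = G x $$ (i, j)"
      using ev
    proof eventually_elim
      case (elim x)
      then have c: "P x \<in> carrier_mat n n" "G x \<in> carrier_mat n n"
        and GP: "G x * P x = K x" and det: "det (P x) \<noteq> 0"
        by blast+
      have cK: "K x \<in> carrier_mat n n"
        unfolding GP[symmetric] using c(2,1) by (rule mult_carrier_mat)
      note adj = adj_mat[OF c(1)]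
      have "K x * adj_mat (P x) = G x * (P x * adj_mat (P x))"
        unfolding GP[symmetric] by (rule assoc_mult_mat[OF c(2,1) adj(1)])
      also have "\<dots> = det (P x) \<cdot>\<^sub>m G x"
        unfolding adj(2) using c(2) by (simp add: mult_smult_distrib[OF c(2) one_carrier_mat])
      finally have "(K x * adj_mat (P x)) $$ (i, j) = det (P x) * G x $$ (i, j)"
        using c(2) ij by simp
      then show ?case
        using det unfolding index_mult_mat_sum[OF cK adj(1) ij] by simp
    qed
  qed
qed

section \<open>Invertible matrices\<close>

lemma GL_inverse:
  assumes "P \<in> GL n"
  obtains Q where "Q \<in> carrier_mat n n" "P * Q = 1\<^sub>m n" "Q * P = 1\<^sub>m n"
proof -
  obtain Q where P: "P \<in> carrier_mat n n" and Q: "P * Q = 1\<^sub>m n" "Q * P = 1\<^sub>m (dim_row Q)"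
    using assms by (auto simp: GL_def invertible_mat_def inverts_mat_def)
  have "dim_col Q = n" "dim_row Q = n"
    using arg_cong[OF Q(1), of dim_col] arg_cong[OF Q(2), of dim_col] P by simp_all
  then show thesis
    using that Q by auto
qed

lemma GL_iff_det: "P \<in> GL n \<longleftrightarrow> P \<in> carrier_mat n n \<and> det P \<noteq> 0"
proof
  assume "P \<in> GL n"
  then obtain Q where "Q \<in> carrier_mat n n" "P * Q = 1\<^sub>m n"
    by (rule GL_inverse)
  moreover have "P \<in> carrier_mat n n"
    using \<open>P \<in> GL n\<close> by (simp add: GL_def)
  ultimately show "P \<in> carrier_mat n n \<and> det P \<noteq> 0"
    using det_mult[of P n Q] by fastforce
next
  assume P: "P \<in> carrier_mat n n \<and> det P \<noteq> 0"
  let ?Q = "inverse (det P) \<cdot>\<^sub>m adj_mat P"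
  have adj: "P \<in> carrier_mat n n" "adj_mat P \<in> carrier_mat n n"
    "P * adj_mat P = det P \<cdot>\<^sub>m 1\<^sub>m n" "adj_mat P * P = det P \<cdot>\<^sub>m 1\<^sub>m n"
    using P adj_mat[of P n] by blast+
  have "inverse (det P) \<cdot>\<^sub>m (det P \<cdot>\<^sub>m 1\<^sub>m n) = 1\<^sub>m n"
    using P by (intro eq_matI) auto
  then have "P * ?Q = 1\<^sub>m n" "?Q * P = 1\<^sub>m n"
    using adj(3,4) mult_smult_distrib[OF adj(1,2)] mult_smult_assoc_mat[OF adj(2,1)] by simp_all
  then show "P \<in> GL n"
    using P adj(2) unfolding GL_def invertible_mat_def inverts_mat_def
    by (auto intro!: exI[of _ ?Q])
qed

lemma one_mat_in_GL: "1\<^sub>m n \<in> GL n"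
  by (simp add: GL_iff_det)

section \<open>Powers of a matrix and its exponential series\<close>

lemma smult_pow_mat:
  fixes E :: "'a::comm_ring_1 mat"
  assumes "E \<in> carrier_mat n n"
  shows "(c \<cdot>\<^sub>m E) ^\<^sub>m l = c ^ l \<cdot>\<^sub>m E ^\<^sub>m l"
proof (induction l)
  case 0
  show ?case using assms by (auto intro: eq_matI)
next
  case (Suc l)
  have E: "E ^\<^sub>m l \<in> carrier_mat n n"
    using assms by simp
  show ?case
    using assms E by (auto simp: Suc mult_ac index_mult_mat_sum[of _ n n _ n] sum_distrib_left
      simp del: index_mult_mat(1) intro!: eq_matI)
qed

lemma pow_mat_Suc_left:
  fixes E :: "'a::comm_ring_1 mat"
  assumes "E \<in> carrier_mat n n"
  shows "E ^\<^sub>m Suc l = E * E ^\<^sub>m l"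
proof (induction l)
  case 0
  show ?case using assms by simp
next
  case (Suc l)
  then show ?case
    using assms by (metis assoc_mult_mat pow_carrier_mat pow_mat.simps(2))
qed

text \<open>The sum of the moduli of all entries acts as a submultiplicative norm. The bound lets a
  scalar exponential series dominate every entry of the matrix exponential.\<close>

lemma norm_pow_mat_le:
  fixes E :: "complex mat"
  assumes "E \<in> carrier_mat n n" "i < n" "j < n"
  shows "norm ((E ^\<^sub>m l) $$ (i, j)) \<le> (\<Sum>r<n. \<Sum>s<n. norm (E $$ (r, s))) ^ l"
  using assms(3)
proof (induction l arbitrary: j)
  case 0
  then show ?case using assms by auto
next
  case (Suc l)
  let ?R = "\<Sum>r<n. \<Sum>s<n. norm (E $$ (r, s))"
  have R: "0 \<le> ?R"
    by (intro sum_nonneg) auto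
  have "(E ^\<^sub>m Suc l) $$ (i, j) = (\<Sum>r<n. (E ^\<^sub>m l) $$ (i, r) * E $$ (r, j))"
    using assms Suc.prems by (simp add: index_mult_mat_sum[of _ n n _ n] del: index_mult_mat(1))
  also have "norm \<dots> \<le> (\<Sum>r<n. norm ((E ^\<^sub>m l) $$ (i, r)) * norm (E $$ (r, j)))"
    by (rule order_trans[OF norm_sum]) (simp add: norm_mult)
  also have "\<dots> \<le> (\<Sum>r<n. ?R ^ l * (\<Sum>s<n. norm (E $$ (r, s))))"
    by (intro sum_mono mult_mono Suc.IH member_le_sum) (use Suc.prems R in auto)
  also have "\<dots> = ?R ^ Suc l"
    unfolding power_Suc2 by (rule sum_distrib_left[symmetric])
  finally show ?case .
qed

text \<open>Each entry becomes a scalar power series in \<zeta>, the form to which comparison and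
  termwise differentiation apply.\<close>

lemma mat_exp_smult_index:
  assumes "E \<in> carrier_mat n n" "i < n" "j < n"
  shows "mat_exp (\<zeta> \<cdot>\<^sub>m E) $$ (i, j) = (\<Sum>l. (E ^\<^sub>m l) $$ (i, j) / fact l * \<zeta> ^ l)"
proof -
  have "((\<zeta> \<cdot>\<^sub>m E) ^\<^sub>m l) $$ (i, j) = \<zeta> ^ l * (E ^\<^sub>m l) $$ (i, j)" for l
    using assms by (subst smult_pow_mat[OF assms(1)]) simp
  then show ?thesis
    using assms by (simp add: mat_exp_def mult.commute)
qed

lemma mat_exp_carrier: "E \<in> carrier_mat n n \<Longrightarrow> mat_exp E \<in> carrier_mat n n"
  by (simp add: mat_exp_def)

lemma summable_mat_exp:
  assumes "E \<in> carrier_mat n n" "i < n" "j < n"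
  shows "summable (\<lambda>l. (E ^\<^sub>m l) $$ (i, j) / fact l * \<zeta> ^ l :: complex)"
proof (rule summable_comparison_test')
  let ?R = "\<Sum>r<n. \<Sum>s<n. norm (E $$ (r, s))"
  show "summable (\<lambda>l. inverse (fact l) * (?R * norm \<zeta>) ^ l)"
    by (rule summable_exp)
  show "norm ((E ^\<^sub>m l) $$ (i, j) / fact l * \<zeta> ^ l) \<le> inverse (fact l) * (?R * norm \<zeta>) ^ l" for l
  proof -
    have "norm ((E ^\<^sub>m l) $$ (i, j) / fact l * \<zeta> ^ l)
        = norm ((E ^\<^sub>m l) $$ (i, j)) * norm \<zeta> ^ l / fact l"
      by (simp add: norm_mult norm_divide norm_power)
    also have "\<dots> \<le> ?R ^ l * norm \<zeta> ^ l / fact l"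
      by (intro divide_right_mono mult_right_mono norm_pow_mat_le assms) auto
    finally show ?thesis
      by (simp add: power_mult_distrib divide_inverse mult.commute)
  qed
qed

text \<open>Termwise differentiation: \<open>diffs\<close> cancels one factor of the factorial and
  leaves \<open>E ^\<^sub>m Suc l\<close>, from which one \<open>E\<close> is split off on the left
  and pulled out of the series.\<close>

lemma has_field_derivative_mat_exp:
  assumes "E \<in> carrier_mat n n" "i < n" "j < n"
  shows "((\<lambda>\<zeta>. mat_exp (\<zeta> \<cdot>\<^sub>m E) $$ (i, j)) has_field_derivative
    (E * mat_exp (\<zeta> \<cdot>\<^sub>m E)) $$ (i, j)) (at \<zeta>)"
proof -
  let ?c = "\<lambda>i l. (E ^\<^sub>m l) $$ (i, j) / fact l"
  have c: "mat_exp (\<zeta> \<cdot>\<^sub>m E) \<in> carrier_mat n n"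
    using assms by (intro mat_exp_carrier) simp
  have "diffs (?c i) l = (\<Sum>r<n. E $$ (i, r) * ?c r l)" for l
  proof -
    have "(E ^\<^sub>m Suc l) $$ (i, j) = (\<Sum>r<n. E $$ (i, r) * (E ^\<^sub>m l) $$ (r, j))"
      using assms unfolding pow_mat_Suc_left[OF assms(1)] by (intro index_mult_mat_sum) auto
    moreover have "diffs (?c i) l = (E ^\<^sub>m Suc l) $$ (i, j) / fact l"
      unfolding diffs_def fact_Suc of_nat_mult
      by (metis (no_types, lifting) fact_Suc mult_divide_mult_cancel_left_if of_nat_Suc of_nat_neq_0
        of_nat_fact of_nat_mult times_divide_eq_right)
    ultimately show ?thesis
      by (simp add: sum_divide_distrib)
  qed
  then have "(\<Sum>l. diffs (?c i) l * \<zeta> ^ l) = (\<Sum>l. \<Sum>r<n. E $$ (i, r) * (?c r l * \<zeta> ^ l))"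
    by (intro suminf_cong) (simp add: sum_distrib_right mult.assoc)
  also have "\<dots> = (\<Sum>r<n. \<Sum>l. E $$ (i, r) * (?c r l * \<zeta> ^ l))"
    by (intro suminf_sum summable_mult summable_mat_exp[OF assms(1)] assms) simp
  also have "\<dots> = (\<Sum>r<n. E $$ (i, r) * (\<Sum>l. ?c r l * \<zeta> ^ l))"
    by (intro sum.cong refl suminf_mult summable_mat_exp[OF assms(1)] assms) simp
  also have "\<dots> = (E * mat_exp (\<zeta> \<cdot>\<^sub>m E)) $$ (i, j)"
    using assms by (simp add: index_mult_mat_sum[OF assms(1) c] mat_exp_smult_index[OF assms(1)]
      del: index_mult_mat(1))
  finally show ?thesis
    using termdiffs_strong_converges_everywhere[of "?c i" \<zeta>] summable_mat_exp[OF assms]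
    by (simp add: mat_exp_smult_index[OF assms])
qed

section \<open>Growth of the coefficient matrix\<close>

text \<open>The product of \<open>f\<close> with all factors \<open>z - c\<close> has only removable
  singularities, so it extends to an entire function. At infinity it behaves like
  \<open>z ^ card S * f z\<close>, hence tends to 0, and Liouville's theorem makes it zero.\<close>

lemma vanishing_if_simple_poles:
  fixes f :: "complex \<Rightarrow> complex"
  assumes "finite S" and holo: "f holomorphic_on - S"
    and pole: "\<And>c. c \<in> S \<Longrightarrow> \<exists>l. ((\<lambda>z. (z - c) * f z) \<longlongrightarrow> l) (at c)"
    and inf: "((\<lambda>z. z ^ card S * f z) \<longlongrightarrow> 0) at_infinity"
    and "z \<notin> S"
  shows "f z = 0"
proof -
  define g where "g w = f w * (\<Prod>c\<in>S. w - c)" for w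
  have "\<exists>l. (g \<longlongrightarrow> l) (at c)" if "c \<in> S" for c
  proof -
    obtain l where l: "((\<lambda>z. (z - c) * f z) \<longlongrightarrow> l) (at c)"
      using pole \<open>c \<in> S\<close> by blast
    have g_eq: "g w = (w - c) * f w * (\<Prod>b\<in>S - {c}. w - b)" for w
      using prod.remove[OF \<open>finite S\<close> that, of "\<lambda>b. w - b"] by (simp add: g_def)
    have "((\<lambda>w. (w - c) * f w * (\<Prod>b\<in>S - {c}. w - b)) \<longlongrightarrow> l * (\<Prod>b\<in>S - {c}. c - b)) (at c)"
      by (intro tendsto_intros l)
    then show ?thesis
      unfolding g_eq[symmetric] by blast
  qed
  then obtain L where L: "\<And>c. c \<in> S \<Longrightarrow> (g \<longlongrightarrow> L c) (at c)"
    by metis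
  \<comment> \<open>The entire extension of \<open>g\<close>: its limits are filled in at the points
    of \<open>S\<close>.\<close>
  define h where "h w = (if w \<in> S then L w else g w)" for w
  have h: "(h \<longlongrightarrow> h c) (at c)" if "c \<in> S" for c
  proof (rule Lim_transform_eventually)
    show "(g \<longlongrightarrow> h c) (at c)"
      using L[OF that] that by (simp add: h_def)
    have "open (- (S - {c}))"
      using \<open>finite S\<close> by (intro open_Compl finite_imp_closed finite_Diff)
    then have "\<forall>\<^sub>F w in at c. w \<in> - (S - {c})"
      by (intro eventually_at_in_open'[of _ c]) auto
    moreover have "\<forall>\<^sub>F w in at c. w \<noteq> c"
      by (simp add: eventually_at_filter)
    ultimately show "\<forall>\<^sub>F w in at c. g w = h w"
      by eventually_elim (auto simp: h_def)
  qed
  have "g holomorphic_on - S"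
    unfolding g_def by (intro holomorphic_intros holo)
  then have "h holomorphic_on UNIV - S"
    by (rule holomorphic_transform[of g, THEN holomorphic_on_subset]) (auto simp: h_def)
  then have "h holomorphic_on UNIV"
    using h \<open>finite S\<close> by (intro no_isolated_singularity'[of S h UNIV]) auto
  moreover have "(h \<longlongrightarrow> 0) at_infinity"
  proof (rule Lim_transform_eventually)
    \<comment> \<open>Each factor \<open>w - c\<close> is split as \<open>w * (1 - c / w)\<close>.
      The powers of \<open>w\<close> are absorbed by the assumption at infinity, and the remaining
      product tends to 1.\<close>
    have "((\<lambda>w. (w ^ card S * f w) * (\<Prod>c\<in>S. 1 - c / w)) \<longlongrightarrow> 0 * (\<Prod>c\<in>S. 1 - 0)) at_infinity"
      by (intro tendsto_intros inf tendsto_divide_0[OF tendsto_const] filterlim_ident)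
    then show "((\<lambda>w. (w ^ card S * f w) * (\<Prod>c\<in>S. 1 - c / w)) \<longlongrightarrow> 0) at_infinity"
      by simp
    have "\<forall>\<^sub>F w in at_infinity. \<forall>c\<in>insert 0 S. w \<noteq> c"
      using \<open>finite S\<close>
      by (intro eventually_ball_finite ballI eventually_not_equal_at_infinity) auto
    then show "\<forall>\<^sub>F w in at_infinity. (w ^ card S * f w) * (\<Prod>c\<in>S. 1 - c / w) = h w"
    proof eventually_elim
      case (elim w)
      have "(\<Prod>c\<in>S. w - c) = (\<Prod>c\<in>S. w * (1 - c / w))"
        using elim by (intro prod.cong) (auto simp: field_simps)
      then show ?case
        using elim by (auto simp: h_def g_def prod.distrib mult_ac)
    qed
  qed
  ultimately have "h z = 0"
    by (rule Liouville_weak_0)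
  then show ?thesis
    using \<open>z \<notin> S\<close> \<open>finite S\<close> by (auto simp: h_def g_def)
qed

section \<open>Uniqueness for linear systems\<close>

lemma higher_deriv_sum_zero:
  assumes "finite I" "open B" "z \<in> B"
    and "\<And>j. j \<in> I \<Longrightarrow> f j holomorphic_on B" and "\<And>j. j \<in> I \<Longrightarrow> (deriv ^^ N) (f j) z = 0"
  shows "(deriv ^^ N) (\<lambda>w. \<Sum>j\<in>I. f j w) z = 0"
  using assms(1,4,5)
proof (induction I)
  case empty
  then show ?case by simp
next
  case (insert i I)
  have "(deriv ^^ N) (\<lambda>w. f i w + (\<Sum>j\<in>I. f j w)) z
      = (deriv ^^ N) (f i) z + (deriv ^^ N) (\<lambda>w. \<Sum>j\<in>I. f j w) z"
    using insert by (intro higher_deriv_add[OF _ _ assms(2,3)] holomorphic_intros) auto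
  then show ?case
    using insert by simp
qed

text \<open>All Taylor coefficients of a solution vanish at a common zero of its components.\<close>

lemma linear_ode_solution_zero:
  fixes u :: "'i \<Rightarrow> complex \<Rightarrow> complex"
  assumes "finite I" "open B" "connected B" "z0 \<in> B"
    and der: "\<And>i z. i \<in> I \<Longrightarrow> z \<in> B \<Longrightarrow>
      (u i has_field_derivative (\<Sum>j\<in>I. a i j z * u j z)) (at z)"
    and a: "\<And>i j. i \<in> I \<Longrightarrow> j \<in> I \<Longrightarrow> a i j holomorphic_on B"
    and zero: "\<And>i. i \<in> I \<Longrightarrow> u i z0 = 0"
    and "i \<in> I" "z \<in> B"
  shows "u i z = 0"
proof -
  have u: "u i holomorphic_on B" if "i \<in> I" for i
    using der[OF that] \<open>open B\<close> holomorphic_on_open by blast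
  \<comment> \<open>The induction treats all components at once, since the equation of one component
    involves the others.\<close>
  have "\<forall>i\<in>I. (deriv ^^ N) (u i) z0 = 0" for N
  proof (induction N rule: less_induct)
    case (less N)
    show ?case
    proof (cases N)
      case 0
      then show ?thesis using zero by simp
    next
      case (Suc M)
      show ?thesis
      proof
        fix i assume i: "i \<in> I"
        have "(deriv ^^ N) (u i) z0 = (deriv ^^ M) (deriv (u i)) z0"
          by (simp add: Suc funpow_Suc_right del: funpow.simps)
        also have "\<dots> = (deriv ^^ M) (\<lambda>z. \<Sum>j\<in>I. a i j z * u j z) z0"
        proof (rule higher_deriv_transform_within_open)
          show "deriv (u i) holomorphic_on B"
            by (intro holomorphic_deriv u i \<open>open B\<close>)
          show "(\<lambda>z. \<Sum>j\<in>I. a i j z * u j z) holomorphic_on B"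
            by (intro holomorphic_intros a u i)
          show "deriv (u i) z = (\<Sum>j\<in>I. a i j z * u j z)" if "z \<in> B" for z
            using der[OF i that] by (rule DERIV_imp_deriv)
        qed (use assms in auto)
        also have "\<dots> = 0"
        proof (rule higher_deriv_sum_zero)
          fix j assume j: "j \<in> I"
          show "(\<lambda>z. a i j z * u j z) holomorphic_on B"
            by (intro holomorphic_intros a u i j)
          have "(deriv ^^ M) (\<lambda>z. a i j z * u j z) z0 = (\<Sum>l = 0..M. of_nat (M choose l) *
              (deriv ^^ l) (a i j) z0 * (deriv ^^ (M - l)) (u j) z0)"
            by (intro higher_deriv_mult[of _ B] a u i j \<open>open B\<close> \<open>z0 \<in> B\<close>)
          \<comment> \<open>Every summand of the Leibniz rule contains a derivative of
            \<open>u j\<close> of order \<open>M - l < N\<close>, which vanishes by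
            induction.\<close>
          also have "\<dots> = 0"
            using less.IH j Suc by (intro sum.neutral) auto
          finally show "(deriv ^^ M) (\<lambda>z. a i j z * u j z) z0 = 0" .
        qed (use assms in auto)
        finally show "(deriv ^^ N) (u i) z0 = 0" .
      qed
    qed
  qed
  then show ?thesis
    using holomorphic_fun_eq_0_on_connected[OF u \<open>open B\<close> \<open>connected B\<close>] assms by blast
qed

section \<open>The coefficient matrix near the singularities\<close>

text \<open>Chain rule: the quotient defining a solution is taken with respect to \<pi> and is a
  ratio of two ordinary difference quotients. In the applications \<open>e\<close> is
  \<open>exp \<zeta>\<close> near a finite singularity and 1 near infinity.\<close>

lemma gl_solution_deriv:
  fixes D :: "complex set"
  assumes sol: "gl_solution n A D \<pi> Y" and "open D" "w \<in> D" "i < n" "j < n"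
    and Y: "((\<lambda>v. Y v $$ (i, j)) has_field_derivative d) (at w)"
    and \<pi>: "(\<pi> has_field_derivative e) (at w)" "e \<noteq> 0"
  shows "e * (A (\<pi> w) * Y w) $$ (i, j) = d"
proof -
  have "((\<lambda>v. (Y v $$ (i, j) - Y w $$ (i, j)) / (\<pi> v - \<pi> w))
      \<longlongrightarrow> (A (\<pi> w) * Y w) $$ (i, j)) (at w within D)"
    using sol assms(3-5) unfolding gl_solution_def by blast
  then have 1: "((\<lambda>v. (Y v $$ (i, j) - Y w $$ (i, j)) / (\<pi> v - \<pi> w))
      \<longlongrightarrow> (A (\<pi> w) * Y w) $$ (i, j)) (at w)"
    by (simp only: at_within_open[OF assms(3,2)])
  have 2: "((\<lambda>v. (Y v $$ (i, j) - Y w $$ (i, j)) / (\<pi> v - \<pi> w)) \<longlongrightarrow> d / e) (at w)"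
  proof (rule Lim_transform_eventually)
    show "((\<lambda>v. ((Y v $$ (i, j) - Y w $$ (i, j)) / (v - w)) / ((\<pi> v - \<pi> w) / (v - w)))
        \<longlongrightarrow> d / e) (at w)"
      using Y \<pi> unfolding has_field_derivative_iff by (intro tendsto_divide)
    \<comment> \<open>For \<open>v \<noteq> w\<close> the factor \<open>v - w\<close> cancels. Where
      \<open>\<pi> v = \<pi> w\<close>, both sides divide by zero and have the value 0.\<close>
    have "\<forall>\<^sub>F v in at w. v \<noteq> w"
      by (simp add: eventually_at_filter)
    then show "\<forall>\<^sub>F v in at w.
        ((Y v $$ (i, j) - Y w $$ (i, j)) / (v - w)) / ((\<pi> v - \<pi> w) / (v - w))
        = (Y v $$ (i, j) - Y w $$ (i, j)) / (\<pi> v - \<pi> w)"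
      by eventually_elim simp
  qed
  show ?thesis
    using tendsto_unique[OF _ 1 2] \<pi>(2) by simp
qed

lemma GL_mult_right_cancel:
  assumes "P * M = Q * M" "M \<in> GL n" "P \<in> carrier_mat n n" "Q \<in> carrier_mat n n"
  shows "P = Q"
proof -
  obtain N where N: "N \<in> carrier_mat n n" "M * N = 1\<^sub>m n"
    using assms(2) by (rule GL_inverse)
  have M: "M \<in> carrier_mat n n"
    using assms(2) by (simp add: GL_def)
  have "P * (M * N) = Q * (M * N)"
    using assms(1) assoc_mult_mat[OF assms(3) M N(1)] assoc_mult_mat[OF assms(4) M N(1)] by simp
  then show ?thesis
    using N assms by simp
qed

lemma analytic_GL_D:
  assumes "analytic_GL n Z D" "open D" "z \<in> D" "i < n" "j < n"
  shows "((\<lambda>z. Z z $$ (i, j)) has_field_derivative deriv (\<lambda>z. Z z $$ (i, j)) z) (at z)"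
    and "((\<lambda>z. Z z $$ (i, j)) \<longlongrightarrow> Z z $$ (i, j)) (at z)"
    and "(deriv (\<lambda>z. Z z $$ (i, j)) \<longlongrightarrow> deriv (\<lambda>z. Z z $$ (i, j)) z) (at z)"
proof -
  have h: "(\<lambda>z. Z z $$ (i, j)) holomorphic_on D"
    using assms by (simp add: analytic_GL_def analytic_imp_holomorphic)
  show der: "((\<lambda>z. Z z $$ (i, j)) has_field_derivative deriv (\<lambda>z. Z z $$ (i, j)) z) (at z)"
    by (rule holomorphic_derivI[OF h assms(2,3)])
  then show "((\<lambda>z. Z z $$ (i, j)) \<longlongrightarrow> Z z $$ (i, j)) (at z)"
    by (rule DERIV_isCont[THEN isContD])
  have "deriv (\<lambda>z. Z z $$ (i, j)) holomorphic_on D"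
    by (rule holomorphic_deriv[OF h assms(2)])
  then show "(deriv (\<lambda>z. Z z $$ (i, j)) \<longlongrightarrow> deriv (\<lambda>z. Z z $$ (i, j)) z) (at z)"
    using assms(2,3)
    by (metis holomorphic_on_imp_continuous_on continuous_on_eq_continuous_at isContD)
qed

text \<open>Differentiating the solution \<open>Z(z) (z - c)^E\<close> and cancelling the power
  gives \<open>(z - c) A Z = (z - c) Z' + Z E\<close>. The right side, called \<open>K\<close>,
  converges at \<open>c\<close>, and \<open>Z c\<close> is invertible, so \<open>(z - c) A\<close>
  converges as well.\<close>

lemma standard_at_finite_simple_pole:
  assumes st: "standard_at_finite n A \<delta> c E" and E: "E \<in> carrier_mat n n" and "\<delta> > 0"
    and A: "\<And>z. z \<in> ball c \<delta> - {c} \<Longrightarrow> A z \<in> carrier_mat n n" and ij: "i < n" "j < n"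
  shows "\<exists>l. ((\<lambda>z. (z - c) * A z $$ (i, j)) \<longlongrightarrow> l) (at c)"
proof -
  define M where "M \<zeta> = mat_exp (\<zeta> \<cdot>\<^sub>m E)" for \<zeta>
  have M: "M \<zeta> \<in> carrier_mat n n" for \<zeta>
    using E by (simp add: M_def mat_exp_carrier)
  obtain Z where Z: "analytic_GL n Z (ball c \<delta>)"
    and sol: "\<And>Y. (\<exists>C\<in>GL n. \<forall>\<zeta>. Re \<zeta> < ln \<delta> \<longrightarrow> Y \<zeta> = Z (c + exp \<zeta>) * M \<zeta> * C) \<Longrightarrow>
      gl_solution n A {\<zeta>. Re \<zeta> < ln \<delta>} (\<lambda>\<zeta>. c + exp \<zeta>) Y"
    using st unfolding standard_at_finite_def M_def by blast
  define Z' where "Z' z = mat n n (\<lambda>(i, j). deriv (\<lambda>z. Z z $$ (i, j)) z)" for z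
  have Z': "Z' z \<in> carrier_mat n n" for z
    by (simp add: Z'_def)
  have Zc: "Z z \<in> carrier_mat n n" if "z \<in> ball c \<delta>" for z
    using Z that by (simp add: analytic_GL_def GL_def)
  define Y where "Y \<zeta> = Z (c + exp \<zeta>) * M \<zeta>" for \<zeta>
  define K where "K z = (z - c) \<cdot>\<^sub>m Z' z + Z z * E" for z
  let ?D = "{\<zeta>. Re \<zeta> < ln \<delta>}"
  have in_ball: "c + exp \<zeta> \<in> ball c \<delta>" if "\<zeta> \<in> ?D" for \<zeta>
    using that \<open>\<delta> > 0\<close> by (simp add: dist_norm) (metis exp_less_cancel_iff exp_ln)
  have Yc: "Y \<zeta> \<in> carrier_mat n n" if "\<zeta> \<in> ?D" for \<zeta>
    using Zc[OF in_ball[OF that]] M by (simp add: Y_def)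
  have Ysol: "gl_solution n A ?D (\<lambda>\<zeta>. c + exp \<zeta>) Y"
  proof (rule sol, intro bexI[of _ "1\<^sub>m n"] allI impI)
    show "Y \<zeta> = Z (c + exp \<zeta>) * M \<zeta> * 1\<^sub>m n" if "Re \<zeta> < ln \<delta>" for \<zeta>
      using right_mult_one_mat[OF Yc[of \<zeta>]] that by (simp add: Y_def)
  qed (rule one_mat_in_GL)
  have key: "((z - c) \<cdot>\<^sub>m A z) * Z z = K z" if z: "z \<in> ball c \<delta> - {c}" for z
  proof -
    \<comment> \<open>Any point of the half plane over \<open>z\<close> would do, because the
      identity to be proved depends on \<open>z\<close> only.\<close>
    define \<zeta> where "\<zeta> = Ln (z - c)"
    have z_eq: "c + exp \<zeta> = z"
      using z by (simp add: \<zeta>_def)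
    have "0 < cmod (z - c)" "cmod (z - c) < \<delta>"
      using z by (auto simp: dist_norm norm_minus_commute)
    then have "ln (cmod (z - c)) < ln \<delta>"
      using ln_less_cancel_iff \<open>\<delta> > 0\<close> by blast
    then have \<zeta>: "\<zeta> \<in> ?D"
      using z by (simp add: \<zeta>_def)
    have zb: "z \<in> ball c \<delta>"
      using z by simp
    note carr = Zc[OF zb] M[of \<zeta>] Z'[of z] A[OF z] E
    have Kc: "K z \<in> carrier_mat n n"
      using carr by (simp add: K_def)
    \<comment> \<open>Solutions are invertible by definition, so the factor \<open>M \<zeta>\<close>
      of \<open>Y \<zeta>\<close> has nonzero determinant and can be cancelled.\<close>
    have "Y \<zeta> \<in> GL n"
      using Ysol \<zeta> by (simp add: gl_solution_def)
    then have MGL: "M \<zeta> \<in> GL n"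
      using carr by (auto simp: GL_iff_det Y_def z_eq det_mult[of _ n])
    show ?thesis
    proof (rule GL_mult_right_cancel[OF _ MGL _ Kc])
      show "(z - c) \<cdot>\<^sub>m A z * Z z * M \<zeta> = K z * M \<zeta>"
      proof (rule eq_matI)
        fix r s assume "r < dim_row (K z * M \<zeta>)" "s < dim_col (K z * M \<zeta>)"
        then have rs: "r < n" "s < n"
          using Kc carr by auto
        let ?Y = "\<lambda>\<xi>. \<Sum>l<n. Z (c + exp \<xi>) $$ (r, l) * M \<xi> $$ (l, s)"
        let ?d = "\<Sum>l<n. (z - c) * Z' z $$ (r, l) * M \<zeta> $$ (l, s) + Z z $$ (r, l) * (E * M \<zeta>) $$ (l, s)"
        have "((\<lambda>\<xi>. Z (c + exp \<xi>) $$ (r, l)) has_field_derivative Z' z $$ (r, l) * exp \<zeta>) (at \<zeta>)"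
          if "l < n" for l
        proof -
          have "((\<lambda>z. Z z $$ (r, l)) has_field_derivative Z' z $$ (r, l)) (at (c + exp \<zeta>))"
            using analytic_GL_D(1)[OF Z _ zb rs(1) that] that rs by (simp add: Z'_def z_eq)
          moreover have "((\<lambda>\<xi>. c + exp \<xi>) has_field_derivative exp \<zeta>) (at \<zeta>)"
            by (auto intro!: derivative_eq_intros)
          ultimately show ?thesis
            by (rule DERIV_chain2)
        qed
        then have "(?Y has_field_derivative ?d) (at \<zeta>)"
          using has_field_derivative_mat_exp[OF E, of _ s \<zeta>, folded M_def] rs
          by (auto intro!: derivative_eq_intros simp: z_eq[symmetric] mult_ac)
        then have "((\<lambda>\<xi>. Y \<xi> $$ (r, s)) has_field_derivative ?d) (at \<zeta>)"
        proof (rule DERIV_cong_ev[OF refl _ refl, THEN iffD2, rotated])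
          have "\<forall>\<^sub>F \<xi> in nhds \<zeta>. \<xi> \<in> ?D"
            using \<zeta> open_halfspace_Re_lt by (intro eventually_nhds_in_open) auto
          then show "\<forall>\<^sub>F \<xi> in nhds \<zeta>. Y \<xi> $$ (r, s) = ?Y \<xi>"
          proof eventually_elim
            case (elim \<xi>)
            show ?case
              unfolding Y_def using Zc[OF in_ball[OF elim]] M rs by (rule index_mult_mat_sum)
          qed
        qed
        \<comment> \<open>The derivative of the projection is \<open>exp \<zeta> = z - c\<close>; it
          supplies the factor in front of \<open>A\<close>.\<close>
        then have "exp \<zeta> * (A (c + exp \<zeta>) * Y \<zeta>) $$ (r, s) = ?d"
          using rs \<zeta> by (intro gl_solution_deriv[OF Ysol])
            (auto intro!: derivative_eq_intros open_halfspace_Re_lt)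
        then have "(z - c) * (A z * (Z z * M \<zeta>)) $$ (r, s) = ?d"
          using z_eq by (auto simp: Y_def)
        also have "?d = ((z - c) \<cdot>\<^sub>m Z' z * M \<zeta>) $$ (r, s) + (Z z * (E * M \<zeta>)) $$ (r, s)"
          using carr rs mult_carrier_mat[OF E M[of \<zeta>]]
          by (simp add: index_mult_mat_sum[of _ n n _ n] sum.distrib mult.assoc del: index_mult_mat(1))
        also have "\<dots> = (K z * M \<zeta>) $$ (r, s)"
          using carr rs by (simp add: K_def add_mult_distrib_mat[of _ n n _ _ n]
            assoc_mult_mat[of "Z z" n n E n "M \<zeta>" n] del: index_mult_mat(1))
        finally show "((z - c) \<cdot>\<^sub>m A z * Z z * M \<zeta>) $$ (r, s) = (K z * M \<zeta>) $$ (r, s)"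
          using carr rs by (simp add: mult_smult_assoc_mat[of _ n n _ n] assoc_mult_mat[of "A z" n n _ n _ n]
            del: index_mult_mat(1))
      qed (use Kc carr in auto)
    qed (use carr in auto)
  qed
  have cb: "c \<in> ball c \<delta>"
    using \<open>\<delta> > 0\<close> by simp
  have ev: "\<forall>\<^sub>F z in at c. z \<in> ball c \<delta> - {c}"
    using \<open>\<delta> > 0\<close> eventually_at_in_open[of "ball c \<delta>" c] by simp
  have "\<exists>l. ((\<lambda>z. ((z - c) \<cdot>\<^sub>m A z) $$ (i, j)) \<longlongrightarrow> l) (at c)"
  proof (rule left_factor_convergent)
    show "((\<lambda>z. Z z $$ (r, s)) \<longlongrightarrow> Z c $$ (r, s)) (at c)" if "r < n" "s < n" for r s
      by (rule analytic_GL_D(2)[OF Z _ cb that]) simp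
    have "Z c \<in> GL n"
      using Z cb by (simp add: analytic_GL_def)
    then show "Z c \<in> carrier_mat n n" "det (Z c) \<noteq> 0"
      by (auto simp: GL_iff_det)
    show "\<forall>\<^sub>F z in at c. Z z \<in> carrier_mat n n \<and> (z - c) \<cdot>\<^sub>m A z \<in> carrier_mat n n \<and>
        (z - c) \<cdot>\<^sub>m A z * Z z = K z"
      using ev by eventually_elim (use Zc A key in auto)
    show "((\<lambda>z. K z $$ (r, s)) \<longlongrightarrow> (c - c) * deriv (\<lambda>z. Z z $$ (r, s)) c
        + (\<Sum>l<n. Z c $$ (r, l) * E $$ (l, s))) (at c)" if rs: "r < n" "s < n" for r s
    proof (rule Lim_transform_eventually)
      show "((\<lambda>z. (z - c) * deriv (\<lambda>z. Z z $$ (r, s)) z + (\<Sum>l<n. Z z $$ (r, l) * E $$ (l, s)))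
          \<longlongrightarrow> (c - c) * deriv (\<lambda>z. Z z $$ (r, s)) c + (\<Sum>l<n. Z c $$ (r, l) * E $$ (l, s))) (at c)"
        using rs by (intro tendsto_intros analytic_GL_D[OF Z _ cb]) auto
      show "\<forall>\<^sub>F z in at c. (z - c) * deriv (\<lambda>z. Z z $$ (r, s)) z
          + (\<Sum>l<n. Z z $$ (r, l) * E $$ (l, s)) = K z $$ (r, s)"
        using ev
      proof eventually_elim
        case (elim z)
        then have "Z z \<in> carrier_mat n n"
          using Zc by simp
        then show ?case
          using E rs Z'[of z] by (simp add: K_def Z'_def index_mult_mat_sum[of _ n n _ n]
            del: index_mult_mat(1))
      qed
    qed
  qed (use ij in auto)
  then obtain l where "((\<lambda>z. ((z - c) \<cdot>\<^sub>m A z) $$ (i, j)) \<longlongrightarrow> l) (at c)" ..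
  moreover have "\<forall>\<^sub>F z in at c. ((z - c) \<cdot>\<^sub>m A z) $$ (i, j) = (z - c) * A z $$ (i, j)"
    using ev
  proof eventually_elim
    case (elim z)
    then have "A z \<in> carrier_mat n n"
      by (rule A)
    then show ?case
      using ij by simp
  qed
  ultimately show ?thesis
    by (intro exI) (rule Lim_transform_eventually)
qed

text \<open>Substituting \<open>Y = diag(z\<^sup>\<kappa>) H(1/z)\<close> into \<open>A Y = Y'\<close> and removing the diagonal factors
  turns the system into \<open>G(z) H(1/z) = - H'(1/z)\<close>, where off the diagonal
  \<open>G\<^sub>i\<^sub>j = z\<^bsup>\<kappa>\<^sub>j - \<kappa>\<^sub>i + 2\<^esup> A\<^sub>i\<^sub>j\<close>.\<close>

lemma standard_at_infinity_growth:
  assumes st: "standard_at_infinity n A \<delta> \<kappa>" and "\<delta> > 0"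
    and A: "\<And>z. cmod z > 1 / \<delta> \<Longrightarrow> A z \<in> carrier_mat n n"
    and ij: "i < n" "j < n" "i \<noteq> j"
  shows "\<exists>l. ((\<lambda>z. z powi (\<kappa> (j + 1) - \<kappa> (i + 1) + 2) * A z $$ (i, j)) \<longlongrightarrow> l) at_infinity"
proof -
  obtain H where H: "analytic_GL n H (ball 0 \<delta>)"
    and sol: "\<And>Y. (\<exists>C\<in>GL n. \<forall>z. cmod z > 1 / \<delta> \<longrightarrow>
        Y z = mat_diag n (\<lambda>i. z powi \<kappa> (i + 1)) * H (1 / z) * C) \<Longrightarrow>
      gl_solution n A {z. cmod z > 1 / \<delta>} (\<lambda>z. z) Y"
    using st unfolding standard_at_infinity_def by blast
  define Y where "Y z = mat_diag n (\<lambda>i. z powi \<kappa> (i + 1)) * H (1 / z)" for z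
  \<comment> \<open>Row \<open>r\<close> of \<open>A Y = Y'\<close> is multiplied by
    \<open>z powi (2 - \<kappa> (r + 1))\<close>. The subtracted diagonal is the part of
    \<open>Y'\<close> that comes from differentiating the power of \<open>z\<close>; it is absent
    from the entry \<open>(i, j)\<close> because \<open>i \<noteq> j\<close>.\<close>
  define G where "G z = mat n n (\<lambda>(r, s). z powi (\<kappa> (s + 1) - \<kappa> (r + 1) + 2) * A z $$ (r, s)
    - (if r = s then of_int (\<kappa> (r + 1)) * z else 0))" for z
  define K where "K z = mat n n (\<lambda>(r, s). - deriv (\<lambda>w. H w $$ (r, s)) (1 / z))" for z
  let ?D = "{z. cmod z > 1 / \<delta>}"
  have openD: "open ?D"
    by (intro open_Collect_less continuous_intros)
  have D: "1 / z \<in> ball 0 \<delta>" "z \<noteq> 0" if "z \<in> ?D" for z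
  proof -
    show "z \<noteq> 0"
      using that \<open>\<delta> > 0\<close> by auto
    then show "1 / z \<in> ball 0 \<delta>"
      using that \<open>\<delta> > 0\<close> by (simp add: norm_divide field_simps)
  qed
  have Hc: "H w \<in> carrier_mat n n" if "w \<in> ball 0 \<delta>" for w
    using H that by (simp add: analytic_GL_def GL_def)
  have Y_mat: "Y z = mat n n (\<lambda>(r, s). z powi \<kappa> (r + 1) * H (1 / z) $$ (r, s))" if "z \<in> ?D" for z
    unfolding Y_def by (rule mat_diag_mult_left[OF Hc[OF D(1)[OF that]]])
  have Yc: "Y z \<in> carrier_mat n n" if "z \<in> ?D" for z
    by (simp add: Y_mat[OF that])
  have Ysol: "gl_solution n A ?D (\<lambda>z. z) Y"
  proof (rule sol, intro bexI[of _ "1\<^sub>m n"] allI impI)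
    show "Y z = mat_diag n (\<lambda>i. z powi \<kappa> (i + 1)) * H (1 / z) * 1\<^sub>m n" if "cmod z > 1 / \<delta>" for z
      using right_mult_one_mat[OF Yc[of z]] that by (simp add: Y_def)
  qed (rule one_mat_in_GL)
  have key: "G z * H (1 / z) = K z" if z: "z \<in> ?D" for z
  proof (rule eq_matI)
    fix r s assume "r < dim_row (K z)" "s < dim_col (K z)"
    then have rs: "r < n" "s < n"
      by (auto simp: K_def)
    note z0 = D(2)[OF z] and zb = D(1)[OF z]
    let ?k = "\<kappa> (r + 1)" and ?h = "\<lambda>l. H (1 / z) $$ (l, s)"
    let ?h' = "deriv (\<lambda>w. H w $$ (r, s)) (1 / z)"
    \<comment> \<open>The inner derivative of \<open>H (1 / z)\<close> is the source of the summand
      2 in the exponent.\<close>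
    have "((\<lambda>w. 1 / w) has_field_derivative - (1 / z\<^sup>2)) (at z)"
      using z0 by (auto intro!: derivative_eq_intros simp: power2_eq_square)
    from DERIV_chain2[OF analytic_GL_D(1)[OF H open_ball zb rs] this]
    have "((\<lambda>w. w powi ?k * H (1 / w) $$ (r, s)) has_field_derivative
        of_int ?k * z powi (?k - 1) * ?h r - z powi ?k * ?h' / z\<^sup>2) (at z)"
      using z0 by (auto intro!: derivative_eq_intros)
    then have der: "((\<lambda>w. Y w $$ (r, s)) has_field_derivative
        of_int ?k * z powi (?k - 1) * ?h r - z powi ?k * ?h' / z\<^sup>2) (at z)"
    proof (rule DERIV_cong_ev[OF refl _ refl, THEN iffD2, rotated])
      show "\<forall>\<^sub>F w in nhds z. Y w $$ (r, s) = w powi ?k * H (1 / w) $$ (r, s)"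
        using eventually_nhds_in_open[OF openD z] by eventually_elim (simp add: Y_mat rs)
    qed
    have "1 * (A z * Y z) $$ (r, s)
        = of_int ?k * z powi (?k - 1) * ?h r - z powi ?k * ?h' / z\<^sup>2"
      by (intro gl_solution_deriv[OF Ysol openD z rs der]) (auto intro!: derivative_eq_intros)
    moreover have "(A z * Y z) $$ (r, s) = (\<Sum>l<n. A z $$ (r, l) * (z powi \<kappa> (l + 1) * ?h l))"
    proof -
      have "A z \<in> carrier_mat n n"
        using A z by simp
      from index_mult_mat_sum[OF this Yc[OF z] rs] show ?thesis
        using rs by (simp add: Y_mat[OF z])
    qed
    ultimately have eq: "(\<Sum>l<n. A z $$ (r, l) * (z powi \<kappa> (l + 1) * ?h l))
        = of_int ?k * z powi (?k - 1) * ?h r - z powi ?k * ?h' / z\<^sup>2"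
      by simp
    have "(G z * H (1 / z)) $$ (r, s) = (\<Sum>l<n. z powi (2 - ?k) * (A z $$ (r, l) * (z powi \<kappa> (l + 1) * ?h l))
        - (if r = l then of_int ?k * z * ?h l else 0))"
    proof -
      have "z powi (\<kappa> (l + 1) - ?k + 2) = z powi (2 - ?k) * z powi \<kappa> (l + 1)" for l
        using z0 by (simp add: power_int_add[symmetric] algebra_simps)
      moreover have "G z \<in> carrier_mat n n"
        by (simp add: G_def)
      ultimately show ?thesis
        using rs by (subst index_mult_mat_sum[OF _ Hc[OF zb] rs])
          (auto simp: G_def algebra_simps intro!: sum.cong)
    qed
    also have "\<dots> = z powi (2 - ?k) * (\<Sum>l<n. A z $$ (r, l) * (z powi \<kappa> (l + 1) * ?h l)) - of_int ?k * z * ?h r"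
      using rs by (simp add: sum_subtractf sum_distrib_left)
    also have "\<dots> = of_int ?k * (z powi (2 - ?k) * z powi (?k - 1)) * ?h r
        - (z powi (2 - ?k) * z powi ?k) * ?h' / z\<^sup>2 - of_int ?k * z * ?h r"
      unfolding eq by (simp add: algebra_simps)
    also have "z powi (2 - ?k) * z powi (?k - 1) = z"
      using z0 by (simp add: power_int_add[symmetric])
    also have "z powi (2 - ?k) * z powi ?k = z\<^sup>2"
      using z0 by (simp add: power_int_add[symmetric])
    finally show "(G z * H (1 / z)) $$ (r, s) = K z $$ (r, s)"
      using z0 rs by (simp add: K_def)
  qed (use Hc[OF D(1)[OF z]] in \<open>auto simp: G_def K_def\<close>)
  have ev: "\<forall>\<^sub>F z in at_infinity. z \<in> ?D"
    unfolding eventually_at_infinity by (intro exI[of _ "1 / \<delta> + 1"]) auto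
  have inv: "filterlim (\<lambda>z::complex. 1 / z) (at 0) at_infinity"
    using filterlim_inverse_at_iff[of "\<lambda>z::complex. z" at_infinity]
    by (simp add: inverse_eq_divide filterlim_ident)
  have cb: "0 \<in> ball 0 \<delta>"
    using \<open>\<delta> > 0\<close> by simp
  have "\<exists>l. ((\<lambda>z. G z $$ (i, j)) \<longlongrightarrow> l) at_infinity"
  proof (rule left_factor_convergent)
    show "((\<lambda>z. H (1 / z) $$ (r, s)) \<longlongrightarrow> H 0 $$ (r, s)) at_infinity" if "r < n" "s < n" for r s
      by (rule filterlim_compose[OF analytic_GL_D(2)[OF H open_ball cb that] inv])
    show "((\<lambda>z. K z $$ (r, s)) \<longlongrightarrow> - deriv (\<lambda>w. H w $$ (r, s)) 0) at_infinity"
      if "r < n" "s < n" for r s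
      using that unfolding K_def
      by (simp, intro tendsto_minus filterlim_compose[OF analytic_GL_D(3)[OF H open_ball cb that] inv])
    have "H 0 \<in> GL n"
      using H cb by (simp add: analytic_GL_def)
    then show "H 0 \<in> carrier_mat n n" "det (H 0) \<noteq> 0"
      by (auto simp: GL_iff_det)
    show "\<forall>\<^sub>F z in at_infinity. H (1 / z) \<in> carrier_mat n n \<and> G z \<in> carrier_mat n n \<and>
        G z * H (1 / z) = K z"
      using ev
    proof eventually_elim
      case (elim z)
      show ?case
        using Hc[OF D(1)[OF elim]] key[OF elim] by (simp add: G_def)
    qed
  qed (use ij in auto)
  then show ?thesis
    using ij by (simp add: G_def)
qed

section \<open>Continuation of solutions on the covering space\<close>

lemma open_Fin_pt_image: "open U \<Longrightarrow> open (Fin_pt ` U)"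
  by (auto simp: open_sphere_pt_def inj_vimage_image_eq inj_def)

text \<open>Around infinity the exterior of a large disc is taken; it remains connected after
  infinity is removed. This allows the vanishing of components to be carried across points over
  infinity, where solutions need not be defined.\<close>

lemma sphere_nhd_connected_finite_part:
  assumes "open V" "x \<in> V"
  obtains W where "open W" "x \<in> W" "W \<subseteq> V" "connected (Fin_pt -` W)"
proof (cases x)
  case (Fin_pt c)
  have "open (Fin_pt -` V)" "c \<in> Fin_pt -` V"
    using assms Fin_pt by (auto simp: open_sphere_pt_def)
  then obtain e where e: "e > 0" "ball c e \<subseteq> Fin_pt -` V"
    using openE by blast
  show thesis
  proof (rule that[of "Fin_pt ` ball c e"])
    show "connected (Fin_pt -` Fin_pt ` ball c e)"
      by (simp add: inj_vimage_image_eq inj_def)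
  qed (use e Fin_pt in \<open>auto intro: open_Fin_pt_image\<close>)
next
  case Inf_pt
  then have "bounded (- (Fin_pt -` V))"
    using assms by (auto simp: open_sphere_pt_def compact_imp_bounded)
  then obtain R where "\<forall>z\<in>- (Fin_pt -` V). cmod z \<le> R"
    by (auto simp: bounded_iff)
  then have R: "- (Fin_pt -` V) \<subseteq> cball 0 R"
    by auto
  define W where "W = insert Inf_pt (Fin_pt ` (- cball 0 R))"
  have vim: "Fin_pt -` W = - cball 0 R"
    by (auto simp: W_def)
  show thesis
  proof (rule that[of W])
    show "open W"
      unfolding open_sphere_pt_def vim by (simp add: open_Compl)
    show "connected (Fin_pt -` W)"
      unfolding vim by (rule connected_complement_bounded_convex) auto
    show "W \<subseteq> V"
      using R assms(2) Inf_pt by (auto simp: W_def)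
  qed (simp add: W_def Inf_pt)
qed

lemma open_punctured_sphere: "open (punctured_sphere a m)"
proof -
  have "Fin_pt -` punctured_sphere a m = - a ` {1..m}"
    by (auto simp: punctured_sphere_def)
  moreover have "finite (a ` {1..m})"
    by simp
  ultimately show ?thesis
    by (simp add: open_sphere_pt_def open_Compl finite_imp_closed finite_imp_compact)
qed

lemma continuous_on_Fin_pt: "continuous_on U Fin_pt"
  by (rule continuous_on_subset[of UNIV])
    (auto simp: continuous_on_open_vimage open_sphere_pt_def)

text \<open>A neighbourhood of infinity without finite points would have the whole plane as its
  compact complement.\<close>

lemma open_sphere_has_Fin_pt:
  assumes "open U" "x \<in> U"
  obtains z where "Fin_pt z \<in> U"
proof (cases x)
  case (Fin_pt c)
  then show thesis using that assms by blast
next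
  case Inf_pt
  then have "compact (- (Fin_pt -` U))"
    using assms by (simp add: open_sphere_pt_def)
  then have "- (Fin_pt -` U) \<noteq> UNIV"
    using not_compact_UNIV by metis
  then show thesis using that by auto
qed

lemma covering_sheet:
  fixes \<rho> :: "'t::topological_space \<Rightarrow> 's::topological_space"
  assumes cov: "covering_space St \<rho> S" and "open S" "w \<in> St"
  obtains u V q where "w \<in> u" "openin (top_of_set St) u" "open V" "V \<subseteq> S" "homeomorphism u V \<rho> q"
proof -
  have "\<rho> w \<in> S"
    using cov \<open>w \<in> St\<close> by (auto simp: covering_space_def)
  then have "\<exists>V. \<rho> w \<in> V \<and> openin (top_of_set S) V \<and> (\<exists>\<U>. \<Union>\<U> = St \<inter> \<rho> -` V \<and>
      (\<forall>u\<in>\<U>. openin (top_of_set St) u) \<and> pairwise disjnt \<U> \<and>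
      (\<forall>u\<in>\<U>. \<exists>q. homeomorphism u V \<rho> q))"
    using cov by (simp add: covering_space_def)
  then obtain V where V: "\<rho> w \<in> V" "openin (top_of_set S) V" and "\<exists>\<U>. \<Union>\<U> = St \<inter> \<rho> -` V \<and>
      (\<forall>u\<in>\<U>. openin (top_of_set St) u) \<and> pairwise disjnt \<U> \<and>
      (\<forall>u\<in>\<U>. \<exists>q. homeomorphism u V \<rho> q)"
    by (elim exE[of "\<lambda>V. \<rho> w \<in> V \<and> _ V"] conjE) (rule that)
  then obtain \<U> where \<U>: "\<Union>\<U> = St \<inter> \<rho> -` V"
      "\<forall>u\<in>\<U>. openin (top_of_set St) u" "\<forall>u\<in>\<U>. \<exists>q. homeomorphism u V \<rho> q"
    by (elim exE conjE) (rule that)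
  have "w \<in> \<Union>\<U>"
    using \<U>(1) V(1) \<open>w \<in> St\<close> by simp
  then obtain u where "u \<in> \<U>" and "w \<in> u"
    by (rule UnionE)
  with \<U>(2) have u: "w \<in> u" "openin (top_of_set St) u"
    by simp_all
  obtain q where q: "homeomorphism u V \<rho> q"
    using bspec[OF \<U>(3) \<open>u \<in> \<U>\<close>] by (rule exE)
  have "open V"
    using V(2) \<open>open S\<close> by (meson openin_open_trans open_openin openin_open_eq)
  moreover have "V \<subseteq> S"
    using V(2) by (rule openin_imp_subset)
  ultimately show thesis
    using that[OF u] q by blast
qed

text \<open>The local inverse of the projection pulls \<open>T\<close> back to a nonempty open set
  of the sphere, which contains a finite point.\<close>

lemma finite_part_dense:
  assumes cov: "covering_space St \<rho> S" and "open S" and T: "openin (top_of_set St) T" "w \<in> T"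
  shows "\<exists>v\<in>T. v \<in> finite_part St \<rho>"
proof -
  have "w \<in> St"
    using T openin_imp_subset by blast
  then obtain u V q where u: "w \<in> u" "openin (top_of_set St) u" and V: "open V"
    and q: "homeomorphism u V \<rho> q"
    using covering_sheet[OF cov \<open>open S\<close>] by metis
  obtain T' where T': "open T'" "T = St \<inter> T'"
    using T(1) by (auto simp: openin_open)
  have "open (V \<inter> q -` T')"
    by (rule continuous_open_preimage[OF homeomorphism_cont2[OF q] V T'(1)])
  moreover have "\<rho> w \<in> V \<inter> q -` T'"
    using u(1) T(2) T'(2) homeomorphism_image1[OF q] homeomorphism_apply1[OF q] by auto
  ultimately obtain z where z: "Fin_pt z \<in> V \<inter> q -` T'"
    by (rule open_sphere_has_Fin_pt)
  then have "q (Fin_pt z) \<in> u" "\<rho> (q (Fin_pt z)) = Fin_pt z"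
    using homeomorphism_image2[OF q] homeomorphism_apply2[OF q] by auto
  then have "q (Fin_pt z) \<in> T" "q (Fin_pt z) \<in> finite_part St \<rho>"
    using z T'(2) openin_imp_subset[OF u(2)] by (auto simp: finite_part_def)
  then show ?thesis by blast
qed

text \<open>The sheet through \<open>w\<close> is cut down to a neighbourhood whose finite part is
  connected. For \<open>w\<close> over infinity the chart \<open>q\<close> covers the sheet with
  \<open>w\<close> removed.\<close>

lemma covering_chart:
  assumes cov: "covering_space St \<rho> S" and "open S" "w \<in> St"
  obtains T B q where "openin (top_of_set St) T" "w \<in> T" "open B" "connected B"
    "Fin_pt ` B \<subseteq> S" "continuous_on B q" "q ` B = T \<inter> finite_part St \<rho>"
    "\<And>z. z \<in> B \<Longrightarrow> \<rho> (q z) = Fin_pt z"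
proof -
  obtain u V q where u: "w \<in> u" "openin (top_of_set St) u" and V: "open V" "V \<subseteq> S"
    and q: "homeomorphism u V \<rho> q"
    using covering_sheet[OF assms] by metis
  have "\<rho> w \<in> V"
    using u(1) homeomorphism_image1[OF q] by auto
  with V(1) obtain W where W: "open W" "\<rho> w \<in> W" "W \<subseteq> V" "connected (Fin_pt -` W)"
    by (rule sphere_nhd_connected_finite_part)
  show thesis
  proof (rule that[of "u \<inter> \<rho> -` W" "Fin_pt -` W" "q \<circ> Fin_pt"])
    have "openin (top_of_set u) (u \<inter> \<rho> -` W)"
      using homeomorphism_cont1[OF q] W(1) by (rule continuous_openin_preimage_gen)
    then show "openin (top_of_set St) (u \<inter> \<rho> -` W)"
      using u(2) openin_trans by blast
    show "w \<in> u \<inter> \<rho> -` W"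
      using u W by simp
    show "connected (Fin_pt -` W)"
      by (rule W(4))
    show "open (Fin_pt -` W)"
      using W(1) by (simp add: open_sphere_pt_def)
    show "Fin_pt ` (Fin_pt -` W) \<subseteq> S"
      using W(3) V(2) by auto
    show "continuous_on (Fin_pt -` W) (q \<circ> Fin_pt)"
      using W(3) by (intro continuous_on_compose continuous_on_Fin_pt
        continuous_on_subset[OF homeomorphism_cont2[OF q]]) auto
    show "\<rho> ((q \<circ> Fin_pt) z) = Fin_pt z" if "z \<in> Fin_pt -` W" for z
      using homeomorphism_apply2[OF q] that W(3) by auto
    show "(q \<circ> Fin_pt) ` (Fin_pt -` W) = u \<inter> \<rho> -` W \<inter> finite_part St \<rho>"
    proof (intro equalityI subsetI)
      fix v assume "v \<in> (q \<circ> Fin_pt) ` (Fin_pt -` W)"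
      then obtain z where z: "Fin_pt z \<in> W" "v = q (Fin_pt z)"
        by auto
      then have "\<rho> v = Fin_pt z" "v \<in> u"
        using W(3) homeomorphism_apply2[OF q] homeomorphism_image2[OF q] by auto
      then show "v \<in> u \<inter> \<rho> -` W \<inter> finite_part St \<rho>"
        using z openin_imp_subset[OF u(2)] by (auto simp: finite_part_def)
    next
      fix v assume v: "v \<in> u \<inter> \<rho> -` W \<inter> finite_part St \<rho>"
      then obtain z where z: "\<rho> v = Fin_pt z"
        by (cases "\<rho> v") (auto simp: finite_part_def)
      then have "v = (q \<circ> Fin_pt) z"
        using v homeomorphism_apply1[OF q, of v] by simp
      then show "v \<in> (q \<circ> Fin_pt) ` (Fin_pt -` W)"
        using v z by auto
    qed
  qed
qed

text \<open>In a simply connected set any two loops are freely homotopic, in particular the constant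
  loops at \<open>x\<close> and \<open>y\<close>; such a homotopy traces a path from
  \<open>x\<close> to \<open>y\<close>.\<close>

lemma simply_connected_imp_connected_space:
  assumes "simply_connected S"
  shows "connected S"
proof -
  have "path_component S x y" if "x \<in> S" "y \<in> S" for x y
  proof -
    have "homotopic_loops S (\<lambda>_. x) (\<lambda>_. y)"
      using assms[unfolded simply_connected_def, rule_format, of "\<lambda>_. x" "\<lambda>_. y"] that
      by (auto simp: path_def pathstart_def pathfinish_def path_image_def)
    then show ?thesis
      using homotopic_loops_imp_path_component_value[of S "\<lambda>_. x" "\<lambda>_. y" 0] by simp
  qed
  then show ?thesis
    by (intro path_connected_imp_connected) (simp add: path_connected_component)
qed

text \<open>As \<open>q\<close> inverts \<pi> locally, composing with \<open>q\<close> turns the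
  quotient with respect to \<pi> into an ordinary difference quotient.\<close>

lemma gl_solution_chart_derivative:
  assumes sol: "gl_solution n A D \<pi> Y" and q: "continuous_on B q" "open B" "q ` B \<subseteq> D"
    and \<pi>: "\<And>z. z \<in> B \<Longrightarrow> \<pi> (q z) = z" and "z \<in> B" "i < n" "j < n"
  shows "((\<lambda>z. Y (q z) $$ (i, j)) has_field_derivative (A z * Y (q z)) $$ (i, j)) (at z)"
proof -
  have evB: "\<forall>\<^sub>F v in at z. v \<in> B"
    using q(2) \<open>z \<in> B\<close> by (rule eventually_at_in_open')
  have evz: "\<forall>\<^sub>F v in at z. v \<noteq> z"
    by (simp add: eventually_at_filter)
  have "(q \<longlongrightarrow> q z) (at z)"
    using q \<open>z \<in> B\<close> by (metis continuous_on_def at_within_open)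
  \<comment> \<open>\<open>q\<close> is injective on \<open>B\<close>, so punctured neighbourhoods
    go to punctured neighbourhoods and the limits compose.\<close>
  moreover have "\<forall>\<^sub>F v in at z. q v \<in> D \<and> q v \<noteq> q z"
    using evB evz by eventually_elim (use q(3) \<pi> \<open>z \<in> B\<close> in \<open>metis image_subset_iff\<close>)
  ultimately have flim: "filterlim q (at (q z) within D) (at z)"
    by (simp add: filterlim_at)
  have "((\<lambda>w. (Y w $$ (i, j) - Y (q z) $$ (i, j)) / (\<pi> w - \<pi> (q z)))
      \<longlongrightarrow> (A (\<pi> (q z)) * Y (q z)) $$ (i, j)) (at (q z) within D)"
    using sol q(3) assms(6-8) unfolding gl_solution_def by blast
  from filterlim_compose[OF this flim]
  have lim: "((\<lambda>v. (Y (q v) $$ (i, j) - Y (q z) $$ (i, j)) / (\<pi> (q v) - z))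
      \<longlongrightarrow> (A z * Y (q z)) $$ (i, j)) (at z)"
    by (simp only: \<pi>[OF \<open>z \<in> B\<close>])
  show ?thesis
    unfolding has_field_derivative_iff
  proof (rule Lim_transform_eventually[OF lim])
    show "\<forall>\<^sub>F v in at z. (Y (q v) $$ (i, j) - Y (q z) $$ (i, j)) / (\<pi> (q v) - z)
        = (Y (q v) $$ (i, j) - Y (q z) $$ (i, j)) / (v - z)"
      using evB by eventually_elim (simp add: \<pi>)
  qed
qed

lemma index_mult_mat_vec_sum:
  assumes "P \<in> carrier_mat n r" "v \<in> carrier_vec r" "i < n"
  shows "(P *\<^sub>v v) $ i = (\<Sum>l<r. P $$ (i, l) * v $ l)"
  using assms by (simp add: scalar_prod_def atLeast0LessThan)

text \<open>By the zero block, the components of \<open>Y v\<close> from index \<open>k\<close> on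
  satisfy a linear system of their own. A zero of all of them spreads over a chart by uniqueness and
  then over the covering space by connectedness.\<close>

lemma global_solution_rows_zero:
  assumes cov: "universal_covering St \<rho> (punctured_sphere a m)"
    and sol: "global_solution St \<rho> n A Y"
    and A: "\<And>z. z \<notin> a ` {1..m} \<Longrightarrow> A z \<in> carrier_mat n n"
    and A_holo: "\<And>i j. i < n \<Longrightarrow> j < n \<Longrightarrow> (\<lambda>z. A z $$ (i, j)) holomorphic_on - a ` {1..m}"
    and block: "\<And>z i j. z \<notin> a ` {1..m} \<Longrightarrow> k \<le> i \<Longrightarrow> i < n \<Longrightarrow> j < k \<Longrightarrow> A z $$ (i, j) = 0"
    and v: "v \<in> carrier_vec n" and xy: "x \<in> finite_part St \<rho>" "y \<in> finite_part St \<rho>"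
    and zero: "\<forall>i\<in>{k..<n}. (Y x *\<^sub>v v) $ i = 0"
  shows "\<forall>i\<in>{k..<n}. (Y y *\<^sub>v v) $ i = 0"
proof -
  let ?S = "punctured_sphere a m" and ?Q = "\<lambda>w. \<forall>i\<in>{k..<n}. (Y w *\<^sub>v v) $ i = 0"
  have cs: "covering_space St \<rho> ?S" and conn: "connected St"
    using cov simply_connected_imp_connected_space by (auto simp: universal_covering_def)
  have Yc: "Y w \<in> carrier_mat n n" if "w \<in> finite_part St \<rho>" for w
    using sol that by (simp add: global_solution_def gl_solution_def GL_def)
  show ?thesis
  \<comment> \<open>The induction runs over all of \<open>St\<close>, but compares only points of
    its dense finite part. Points over infinity serve merely as centres of charts.\<close>
  proof (rule connected_induction[OF conn, where P = "\<lambda>w. w \<in> finite_part St \<rho>"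
      and Q = ?Q and a = x and b = y])
    fix T w assume T: "openin (top_of_set St) T" "w \<in> T"
    then show "\<exists>w. w \<in> T \<and> w \<in> finite_part St \<rho>"
      using finite_part_dense[OF cs open_punctured_sphere] by blast
  next
    fix w assume "w \<in> St"
    then obtain T B q where T: "openin (top_of_set St) T" "w \<in> T" and B: "open B" "connected B"
        "Fin_pt ` B \<subseteq> ?S" and q: "continuous_on B q" "q ` B = T \<inter> finite_part St \<rho>"
        "\<And>z. z \<in> B \<Longrightarrow> \<rho> (q z) = Fin_pt z"
      using covering_chart[OF cs open_punctured_sphere] by metis
    have BS: "B \<subseteq> - a ` {1..m}"
      using B(3) by (auto simp: punctured_sphere_def)
    have Yq: "Y (q z) \<in> carrier_mat n n" if "z \<in> B" for z
      using Yc q(2) that by blast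
    have "?Q y" if xy: "x \<in> T" "y \<in> T" "x \<in> finite_part St \<rho>" "y \<in> finite_part St \<rho>" "?Q x" for x y
    proof -
      obtain zx zy where z: "zx \<in> B" "x = q zx" "zy \<in> B" "y = q zy"
        using q(2) xy by (metis IntI imageE)
      let ?u = "\<lambda>i z. (Y (q z) *\<^sub>v v) $ i"
      have "?u i zy = 0" if "i \<in> {k..<n}" for i
      proof (rule linear_ode_solution_zero[of "{k..<n}" B zx ?u "\<lambda>i j z. A z $$ (i, j)"])
        fix i z assume i: "i \<in> {k..<n}" and "z \<in> B"
        then have i': "k \<le> i" "i < n" and zS: "z \<notin> a ` {1..m}"
          using BS by auto
        have u_eq: "(\<Sum>l<n. Y (q z) $$ (i, l) * v $ l) = ?u i z" if "z \<in> B" for z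
          using index_mult_mat_vec_sum[OF Yq[OF that] v i'(2)] by simp
        have "((\<lambda>z. \<Sum>l<n. Y (q z) $$ (i, l) * v $ l) has_field_derivative
            (\<Sum>l<n. (A z * Y (q z)) $$ (i, l) * v $ l)) (at z)"
        proof (intro DERIV_sum DERIV_cmult_right)
          fix l assume "l \<in> {..<n}"
          then show "((\<lambda>z. Y (q z) $$ (i, l)) has_field_derivative (A z * Y (q z)) $$ (i, l)) (at z)"
            using q \<open>z \<in> B\<close> i' B(1)
            by (intro gl_solution_chart_derivative[OF sol[unfolded global_solution_def]]) auto
        qed
        then have "(?u i has_field_derivative (\<Sum>l<n. (A z * Y (q z)) $$ (i, l) * v $ l)) (at z)"
          by (rule has_field_derivative_transform_within_open[OF _ B(1) \<open>z \<in> B\<close> u_eq])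
        also have "(\<Sum>l<n. (A z * Y (q z)) $$ (i, l) * v $ l) = ((A z * Y (q z)) *\<^sub>v v) $ i"
          by (rule index_mult_mat_vec_sum[symmetric, OF mult_carrier_mat[OF A[OF zS] Yq[OF \<open>z \<in> B\<close>]] v i'(2)])
        also have "\<dots> = (A z *\<^sub>v (Y (q z) *\<^sub>v v)) $ i"
          by (simp only: assoc_mult_mat_vec[OF A[OF zS] Yq[OF \<open>z \<in> B\<close>] v])
        also have "\<dots> = (\<Sum>j<n. A z $$ (i, j) * ?u j z)"
          by (rule index_mult_mat_vec_sum[OF A[OF zS] mult_mat_vec_carrier[OF Yq[OF \<open>z \<in> B\<close>] v] i'(2)])
        \<comment> \<open>The columns \<open>j < k\<close> drop out by the zero block, which closes
          the system.\<close>
        also have "\<dots> = (\<Sum>j\<in>{k..<n}. A z $$ (i, j) * ?u j z)"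
          by (rule sum.mono_neutral_right) (use block[OF zS i'] in auto)
        finally show "(?u i has_field_derivative (\<Sum>j\<in>{k..<n}. A z $$ (i, j) * ?u j z)) (at z)" .
      next
        show "(\<lambda>z. A z $$ (i, j)) holomorphic_on B" if "i \<in> {k..<n}" "j \<in> {k..<n}" for i j
          using A_holo[of i j] BS that by (auto intro: holomorphic_on_subset)
      qed (use B z xy that in auto)
      then show ?thesis using z by blast
    qed
    then show "\<exists>T. openin (top_of_set St) T \<and> w \<in> T \<and>
        (\<forall>x\<in>T. \<forall>y\<in>T. x \<in> finite_part St \<rho> \<and> y \<in> finite_part St \<rho> \<and> ?Q x \<longrightarrow> ?Q y)"
      using T by blast
  qed (use xy zero in \<open>auto simp: finite_part_def\<close>)
qed

section \<open>The invariant subspace and the contradiction\<close>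

lemma rows_zero_subspace:
  assumes "P \<in> carrier_mat n n"
  shows "VectorSpace.subspace class_ring {v \<in> carrier_vec n. \<forall>i\<in>{k..<n}. (P *\<^sub>v v) $ i = 0}
    (module_vec TYPE(complex) n)"
proof (rule VectorSpace.subspace.intro[OF vec_vs], rule submodule.intro[OF vec_module])
  show "u \<oplus>\<^bsub>module_vec TYPE(complex) n\<^esub> v \<in> {v \<in> carrier_vec n. \<forall>i\<in>{k..<n}. (P *\<^sub>v v) $ i = 0}"
    if "u \<in> {v \<in> carrier_vec n. \<forall>i\<in>{k..<n}. (P *\<^sub>v v) $ i = 0}"
      "v \<in> {v \<in> carrier_vec n. \<forall>i\<in>{k..<n}. (P *\<^sub>v v) $ i = 0}" for u v
    using that assms by (auto simp: module_vec_simps index_mult_mat_vec_sum[OF assms]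
      distrib_left sum.distrib simp del: index_mult_mat_vec)
qed (use assms in \<open>auto simp: module_vec_simps index_mult_mat_vec_sum[OF assms] mult.left_commute
      sum_distrib_left[symmetric] simp del: index_mult_mat_vec\<close>)

theorem theorem5p2:
  fixes n m :: nat
    and a :: "nat \<Rightarrow> complex"
    and \<gamma> :: "real \<Rightarrow> complex" and t :: "nat \<Rightarrow> real"
    and St :: "'t::topological_space set" and \<rho> :: "'t \<Rightarrow> sphere_pt" and z0 :: 't
    and \<sigma> :: "nat \<Rightarrow> 't \<Rightarrow> 't"
    and A :: "complex \<Rightarrow> complex mat" and \<kappa> :: "nat \<Rightarrow> int"
  assumes "smooth_closed_curve \<gamma>" and "positively_oriented \<gamma>"
    and "in_order_on_curve \<gamma> t a m"
    and "universal_covering St \<rho> (punctured_sphere a m)"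
    and "z0 \<in> St" and "\<rho> z0 \<in> Fin_pt ` inside (path_image \<gamma>)"
    and "\<And>k. k \<in> {1..m} \<Longrightarrow> generating_deck_transformation St \<rho> \<gamma> t z0 k (\<sigma> k)"
    and "n \<ge> 1"
    and "standard_form St \<rho> n m \<sigma> a A \<kappa>"
    and "irreducible_monodromy St \<rho> n m \<sigma> A"
  shows "\<forall>k\<in>{1..<n}. \<kappa> k - \<kappa> (k + 1) \<le> int m - 2"
proof (intro ballI, rule ccontr)
  fix k assume k: "k \<in> {1..<n}" and gap: "\<not> \<kappa> k - \<kappa> (k + 1) \<le> int m - 2"
  let ?S = "a ` {1..m}"
  have mono: "\<kappa> (p + 1) \<le> \<kappa> p" if "p \<in> {1..<n}" for p
    using assms(9) that by (simp add: standard_form_def)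
  have A: "A z \<in> carrier_mat n n" if "z \<notin> ?S" for z
    using assms(9) that by (simp add: standard_form_def)
  have A_holo: "(\<lambda>z. A z $$ (i, j)) holomorphic_on - ?S" if "i < n" "j < n" for i j
    using assms(9) that unfolding standard_form_def by (blast intro: analytic_imp_holomorphic)
  obtain M E \<delta> where adm: "admissible_data n m M E" and "\<delta> > 0"
    and "\<forall>l\<in>{1..m}. ball (a l) \<delta> \<inter> ?S = {a l} \<and> cmod (a l) \<le> 1 / \<delta>"
    and "\<forall>l\<in>{1..m}. standard_at_finite n A \<delta> (a l) (E l)"
    and inf: "standard_at_infinity n A \<delta> \<kappa>"
    using assms(9) unfolding standard_form_def by (elim conjE exE) (rule that)
  then have E: "\<And>l. l \<in> {1..m} \<Longrightarrow> E l \<in> carrier_mat n n"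
    and ball: "\<And>l. l \<in> {1..m} \<Longrightarrow> ball (a l) \<delta> \<inter> ?S = {a l} \<and> cmod (a l) \<le> 1 / \<delta>"
    and fin: "\<And>l. l \<in> {1..m} \<Longrightarrow> standard_at_finite n A \<delta> (a l) (E l)"
    by (simp_all add: admissible_data_def)
  have le: "\<kappa> q \<le> \<kappa> p" if "p \<le> q" "1 \<le> p" "q \<le> n" for p q
    using that
  proof (induction q rule: dec_induct)
    case (step q)
    then show ?case using mono[of q] by simp
  qed simp
  \<comment> \<open>The bound on \<open>cmod (a l)\<close> keeps all singularities out of the region
    around infinity.\<close>
  have A_far: "A z \<in> carrier_mat n n" if "cmod z > 1 / \<delta>" for z
  proof (intro A notI)
    assume "z \<in> ?S"
    then obtain l where "l \<in> {1..m}" "z = a l" by blast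
    then show False using ball[of l] that by simp
  qed
  \<comment> \<open>Matrix indices start at 0 and those of \<kappa> at 1: the rows
    \<open>i \<ge> k\<close> belong to indices at most \<open>\<kappa> (k + 1)\<close>, the columns
    \<open>j < k\<close> to indices at least \<open>\<kappa> k\<close>.\<close>
  have block: "A z $$ (i, j) = 0" if "z \<notin> ?S" "k \<le> i" "i < n" "j < k" for z i j
  proof (rule vanishing_if_simple_poles[where f = "\<lambda>z. A z $$ (i, j)", OF _ A_holo _ _ that(1)])
    fix c assume "c \<in> ?S"
    then obtain l where l: "l \<in> {1..m}" "c = a l" by blast
    show "\<exists>l. ((\<lambda>z. (z - c) * A z $$ (i, j)) \<longlongrightarrow> l) (at c)"
      unfolding l(2)
    proof (rule standard_at_finite_simple_pole[OF fin[OF l(1)] E[OF l(1)] \<open>\<delta> > 0\<close>])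
      show "A z \<in> carrier_mat n n" if "z \<in> ball (a l) \<delta> - {a l}" for z
      proof (intro A notI)
        assume "z \<in> ?S"
        with that have "z \<in> ball (a l) \<delta> \<inter> ?S" by simp
        then have "z \<in> {a l}" by (simp only: conjunct1[OF ball[OF l(1)]])
        then show False using that by simp
      qed
    qed (use that k in auto)
  next
    let ?e = "\<kappa> (j + 1) - \<kappa> (i + 1) + 2"
    obtain l where l: "((\<lambda>z. z powi ?e * A z $$ (i, j)) \<longlongrightarrow> l) at_infinity"
      using standard_at_infinity_growth[OF inf \<open>\<delta> > 0\<close> A_far, of i j]
        \<open>k \<le> i\<close> \<open>i < n\<close> \<open>j < k\<close> by auto
    \<comment> \<open>The surplus of the growth exponent over the number of poles. A gap of at least
      \<open>m - 1\<close> makes \<open>?e\<close> at least \<open>m + 1\<close>, so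
      \<open>d\<close> is positive.\<close>
    define d where "d = nat (?e - int (card ?S))"
    have "\<kappa> (i + 1) \<le> \<kappa> (k + 1)" "\<kappa> k \<le> \<kappa> (j + 1)"
      using that k by (auto intro!: le)
    moreover have "card ?S \<le> m"
      using card_image_le[of "{1..m}" a] by simp
    ultimately have d: "?e = int (card ?S) + int d" "d > 0"
      using gap by (auto simp: d_def)
    \<comment> \<open>Dividing by the surplus power \<open>z ^ d\<close> turns convergence into
      convergence to 0.\<close>
    have "((\<lambda>z. inverse z ^ d * (z powi ?e * A z $$ (i, j))) \<longlongrightarrow> 0 ^ d * l) at_infinity"
      by (intro tendsto_intros l tendsto_inverse_0)
    then have "((\<lambda>z. inverse z ^ d * (z powi ?e * A z $$ (i, j))) \<longlongrightarrow> 0) at_infinity"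
      using d(2) by (simp add: zero_power)
    moreover have "\<forall>\<^sub>F z in at_infinity. inverse z ^ d * (z powi ?e * A z $$ (i, j))
        = z ^ card ?S * A z $$ (i, j)"
      using eventually_not_equal_at_infinity[of "0 :: complex"]
    proof eventually_elim
      case (elim z)
      have "z powi ?e = z ^ card ?S * z ^ d"
        unfolding d(1) using elim by (simp add: power_int_add)
      then show ?case
        using elim by (simp add: power_inverse field_simps)
    qed
    ultimately show "((\<lambda>z. z ^ card ?S * A z $$ (i, j)) \<longlongrightarrow> 0) at_infinity"
      by (rule Lim_transform_eventually)
  qed (use that k in auto)
  obtain X Y where sol: "global_solution St \<rho> n A Y"
    and chi: "\<forall>l\<in>{1..m}. is_chi St \<rho> n Y (\<sigma> l) (X l)" and irr: "irreducible_tuple n m X"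
    using assms(10) unfolding irreducible_monodromy_def monodromy_tuple_def
    by (elim exE conjE) (rule that)
  have z0: "z0 \<in> finite_part St \<rho>"
    using assms(5,6) by (auto simp: finite_part_def)
  have Y: "Y w \<in> GL n" if "w \<in> finite_part St \<rho>" for w
    using sol that by (simp add: global_solution_def gl_solution_def)
  then have Yc: "Y w \<in> carrier_mat n n" if "w \<in> finite_part St \<rho>" for w
    using that by (simp add: GL_def)
  \<comment> \<open>The condition is stated at the base point only;
    \<open>global_solution_rows_zero\<close> transports it between any two finite points.\<close>
  define U where "U = {v \<in> carrier_vec n. \<forall>i\<in>{k..<n}. (Y z0 *\<^sub>v v) $ i = 0}"
  have "X l *\<^sub>v v \<in> U" if l: "l \<in> {1..m}" and v: "v \<in> U" for l v
  proof -
    have Xl: "X l \<in> carrier_mat n n" and chi': "Y z0 = Y (\<sigma> l z0) * X l"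
      using bspec[OF chi l] z0 by (auto simp: is_chi_def)
    have vc: "v \<in> carrier_vec n"
      using v by (simp add: U_def)
    have "deck_transformation St \<rho> (\<sigma> l)"
      using assms(7)[OF l] by (simp add: generating_deck_transformation_def)
    then have "\<sigma> l z0 \<in> St" "\<rho> (\<sigma> l z0) = \<rho> z0"
      using assms(5) by (auto simp: deck_transformation_def homeomorphism_def)
    then have s: "\<sigma> l z0 \<in> finite_part St \<rho>"
      using z0 by (auto simp: finite_part_def)
    \<comment> \<open>The solution with coefficient vector \<open>X l *\<^sub>v v\<close> takes at
      \<open>\<sigma> l z0\<close> the value that the one with \<open>v\<close> takes at
      \<open>z0\<close>. Its last components thus vanish at \<open>\<sigma> l z0\<close>, and
      continuation brings this back to \<open>z0\<close>.\<close>
    have "Y z0 *\<^sub>v v = Y (\<sigma> l z0) *\<^sub>v (X l *\<^sub>v v)"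
      unfolding chi' by (rule assoc_mult_mat_vec[OF Yc[OF s] Xl vc])
    then have "\<forall>i\<in>{k..<n}. (Y (\<sigma> l z0) *\<^sub>v (X l *\<^sub>v v)) $ i = 0"
      using v by (simp add: U_def)
    then have "\<forall>i\<in>{k..<n}. (Y z0 *\<^sub>v (X l *\<^sub>v v)) $ i = 0"
      using global_solution_rows_zero[OF assms(4) sol A A_holo block mult_mat_vec_carrier[OF Xl vc] s z0]
      by blast
    then show ?thesis
      using mult_mat_vec_carrier[OF Xl vc] by (simp add: U_def)
  qed
  moreover have "VectorSpace.subspace class_ring U (module_vec TYPE(complex) n)"
    unfolding U_def by (rule rows_zero_subspace[OF Yc[OF z0]])
  ultimately have U: "U = {0\<^sub>v n} \<or> U = carrier_vec n"
    using irr unfolding irreducible_tuple_def by blast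
  \<comment> \<open>\<open>U\<close> is proper because \<open>Y z0\<close> is invertible: the
    preimage of the unit vector 0 is a nonzero element of \<open>U\<close> since
    \<open>0 < k\<close>, and the preimage of the unit vector \<open>k\<close> lies outside since
    \<open>k < n\<close>.\<close>
  obtain N where N: "N \<in> carrier_mat n n" "Y z0 * N = 1\<^sub>m n"
    using Y[OF z0] by (rule GL_inverse)
  have unit: "Y z0 *\<^sub>v (N *\<^sub>v unit_vec n i) = unit_vec n i" if "i < n" for i
    using N assoc_mult_mat_vec[OF Yc[OF z0] N(1), of "unit_vec n i"] by simp
  have "N *\<^sub>v unit_vec n 0 \<in> U"
    using k N unit[of 0] by (auto simp: U_def)
  moreover have "N *\<^sub>v unit_vec n 0 \<noteq> 0\<^sub>v n"
  proof
    assume eq: "N *\<^sub>v unit_vec n 0 = 0\<^sub>v n"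
    have "(Y z0 *\<^sub>v 0\<^sub>v n) $ 0 = (\<Sum>l<n. Y z0 $$ (0, l) * 0\<^sub>v n $ l)"
      using k by (intro index_mult_mat_vec_sum[OF Yc[OF z0]]) auto
    also have "\<dots> = 0"
      by simp
    finally show False
      using unit[of 0] eq k by simp
  qed
  moreover have "N *\<^sub>v unit_vec n k \<in> carrier_vec n - U"
    using k N unit[of k] by (auto simp: U_def)
  ultimately show False
    using U by blast
qed

end
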